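(* An algebra $\mathbf{A}=\langle A,\oplus,\odot,\vee,\wedge,0,1\rangle$ is a positive MV-algebra if and only if it is an MV-monoidal algebra which satisfies, for all $x,y,z\in A$: if $x\oplus z=y\oplus z$ and $x\odot z=y\odot z$, then $x=y$.
   Context: MV-algebras are taken in the expanded signature $\{\oplus,\odot,\vee,\wedge,\neg,0,1\}$, where $1=\neg 0$, $x\odot y=\neg(\neg x\oplus\neg y)$, $x\vee y=(x\odot\neg y)\oplus y$, $x\wedge y=\neg(\neg x\vee\neg y)$. A \emph{positive MV-algebra} is an algebra of type $\{\oplus,\odot,\vee,\wedge,0,1\}$ (arities $2,2,2,2,0,0$) isomorphic to a subalgebra of the $\{\oplus,\odot,\vee,\wedge,0,1\}$-reduct of some MV-algebra. An \emph{MV-monoidal algebra} is an algebra $\langle A,\oplus,\odot,\vee,\wedge,0,1\rangle$ (arities $2,2,2,2,0,0$) satisfying: (E1) $\langle A,\vee,\wedge\rangle$ is a distributive lattice; (E2) $\langle A,\oplus,0\rangle$ and $\langle A,\odot,1\rangle$ are commutative monoids; (E3) $\oplus$ and $\odot$ distribute over both $\vee$ and $\wedge$; (E4) $(x\oplus y)\odot((x\odot y)\oplus z)=(x\odot(y\oplus z))\oplus(y\odot z)$; (E5) $(x\odot y)\oplus((x\oplus y)\odot z)=(x\oplus(y\odot z))\odot(y\oplus z)$; (E6) $(x\odot y)\oplus z=((x\oplus y)\odot((x\odot y)\oplus z))\vee z$; (E7) $(x\oplus y)\odot z=((x\odot y)\oplus((x\oplus y)\odot z))\wedge z$. *)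

theory Defs
  imports Main
begin

text \<open>Algebras are given by a carrier set together with their operations.
  Signature order: oplus, odot, vee, wedge, 0, 1 (and neg for MV-algebras).\<close>

definition closed_alg ::
  "'a set \<Rightarrow> ('a \<Rightarrow> 'a \<Rightarrow> 'a) \<Rightarrow> ('a \<Rightarrow> 'a \<Rightarrow> 'a) \<Rightarrow> ('a \<Rightarrow> 'a \<Rightarrow> 'a)
   \<Rightarrow> ('a \<Rightarrow> 'a \<Rightarrow> 'a) \<Rightarrow> 'a \<Rightarrow> 'a \<Rightarrow> bool" where
  "closed_alg A pl tm jn mt z u \<longleftrightarrow>
     z \<in> A \<and> u \<in> A \<and>
     (\<forall>x\<in>A. \<forall>y\<in>A. pl x y \<in> A \<and> tm x y \<in> A \<and> jn x y \<in> A \<and> mt x y \<in> A)"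

definition MV_algebra ::
  "'b set \<Rightarrow> ('b \<Rightarrow> 'b \<Rightarrow> 'b) \<Rightarrow> ('b \<Rightarrow> 'b \<Rightarrow> 'b) \<Rightarrow> ('b \<Rightarrow> 'b \<Rightarrow> 'b)
   \<Rightarrow> ('b \<Rightarrow> 'b \<Rightarrow> 'b) \<Rightarrow> ('b \<Rightarrow> 'b) \<Rightarrow> 'b \<Rightarrow> 'b \<Rightarrow> bool" where
  "MV_algebra M pl tm jn mt ng z u \<longleftrightarrow>
     closed_alg M pl tm jn mt z u \<and> (\<forall>x\<in>M. ng x \<in> M) \<and>
     (\<forall>x\<in>M. \<forall>y\<in>M. \<forall>w\<in>M. pl (pl x y) w = pl x (pl y w)) \<and>
     (\<forall>x\<in>M. \<forall>y\<in>M. pl x y = pl y x) \<and>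
     (\<forall>x\<in>M. pl x z = x) \<and>
     (\<forall>x\<in>M. ng (ng x) = x) \<and>
     (\<forall>x\<in>M. pl x (ng z) = ng z) \<and>
     (\<forall>x\<in>M. \<forall>y\<in>M. pl (ng (pl (ng x) y)) y = pl (ng (pl (ng y) x)) x) \<and>
     u = ng z \<and>
     (\<forall>x\<in>M. \<forall>y\<in>M. tm x y = ng (pl (ng x) (ng y))) \<and>
     (\<forall>x\<in>M. \<forall>y\<in>M. jn x y = pl (tm x (ng y)) y) \<and>
     (\<forall>x\<in>M. \<forall>y\<in>M. mt x y = ng (jn (ng x) (ng y)))"

text \<open>An embedding (injective homomorphism of the signature oplus, odot, vee, wedge, 0, 1)
  of A into the reduct of M.  Being isomorphic to a subalgebra of the reduct is
  the same as admitting such an embedding (the image is the subalgebra).\<close>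

definition pos_embedding ::
  "('a \<Rightarrow> 'b) \<Rightarrow> 'a set \<Rightarrow> ('a \<Rightarrow> 'a \<Rightarrow> 'a) \<Rightarrow> ('a \<Rightarrow> 'a \<Rightarrow> 'a) \<Rightarrow> ('a \<Rightarrow> 'a \<Rightarrow> 'a)
   \<Rightarrow> ('a \<Rightarrow> 'a \<Rightarrow> 'a) \<Rightarrow> 'a \<Rightarrow> 'a \<Rightarrow>
   'b set \<Rightarrow> ('b \<Rightarrow> 'b \<Rightarrow> 'b) \<Rightarrow> ('b \<Rightarrow> 'b \<Rightarrow> 'b) \<Rightarrow> ('b \<Rightarrow> 'b \<Rightarrow> 'b)
   \<Rightarrow> ('b \<Rightarrow> 'b \<Rightarrow> 'b) \<Rightarrow> 'b \<Rightarrow> 'b \<Rightarrow> bool" where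
  "pos_embedding h A pl tm jn mt z u M pl' tm' jn' mt' z' u' \<longleftrightarrow>
     h ` A \<subseteq> M \<and> inj_on h A \<and> h z = z' \<and> h u = u' \<and>
     (\<forall>x\<in>A. \<forall>y\<in>A. h (pl x y) = pl' (h x) (h y) \<and> h (tm x y) = tm' (h x) (h y) \<and>
                    h (jn x y) = jn' (h x) (h y) \<and> h (mt x y) = mt' (h x) (h y))"

definition positive_MV ::
  "'a set \<Rightarrow> ('a \<Rightarrow> 'a \<Rightarrow> 'a) \<Rightarrow> ('a \<Rightarrow> 'a \<Rightarrow> 'a) \<Rightarrow> ('a \<Rightarrow> 'a \<Rightarrow> 'a)
   \<Rightarrow> ('a \<Rightarrow> 'a \<Rightarrow> 'a) \<Rightarrow> 'a \<Rightarrow> 'a \<Rightarrow> 'b itself \<Rightarrow> bool" where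
  "positive_MV A pl tm jn mt z u (_ :: 'b itself) \<longleftrightarrow>
     closed_alg A pl tm jn mt z u \<and>
     (\<exists>(M :: 'b set) pl' tm' jn' mt' ng' z' u' h.
        MV_algebra M pl' tm' jn' mt' ng' z' u' \<and>
        pos_embedding h A pl tm jn mt z u M pl' tm' jn' mt' z' u')"

definition MV_monoidal ::
  "'a set \<Rightarrow> ('a \<Rightarrow> 'a \<Rightarrow> 'a) \<Rightarrow> ('a \<Rightarrow> 'a \<Rightarrow> 'a) \<Rightarrow> ('a \<Rightarrow> 'a \<Rightarrow> 'a)
   \<Rightarrow> ('a \<Rightarrow> 'a \<Rightarrow> 'a) \<Rightarrow> 'a \<Rightarrow> 'a \<Rightarrow> bool" where
  "MV_monoidal A pl tm jn mt z u \<longleftrightarrow>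
     closed_alg A pl tm jn mt z u \<and>
     \<comment> \<open>(E1) distributive lattice\<close>
     (\<forall>x\<in>A. \<forall>y\<in>A. \<forall>w\<in>A. jn (jn x y) w = jn x (jn y w) \<and> mt (mt x y) w = mt x (mt y w)) \<and>
     (\<forall>x\<in>A. \<forall>y\<in>A. jn x y = jn y x \<and> mt x y = mt y x) \<and>
     (\<forall>x\<in>A. \<forall>y\<in>A. jn x (mt x y) = x \<and> mt x (jn x y) = x) \<and>
     (\<forall>x\<in>A. \<forall>y\<in>A. \<forall>w\<in>A. mt x (jn y w) = jn (mt x y) (mt x w)) \<and>
     \<comment> \<open>(E2) commutative monoids\<close>
     (\<forall>x\<in>A. \<forall>y\<in>A. \<forall>w\<in>A. pl (pl x y) w = pl x (pl y w) \<and> tm (tm x y) w = tm x (tm y w)) \<and>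
     (\<forall>x\<in>A. \<forall>y\<in>A. pl x y = pl y x \<and> tm x y = tm y x) \<and>
     (\<forall>x\<in>A. pl x z = x \<and> tm x u = x) \<and>
     \<comment> \<open>(E3) distributivity over join and meet\<close>
     (\<forall>x\<in>A. \<forall>y\<in>A. \<forall>w\<in>A.
        pl x (jn y w) = jn (pl x y) (pl x w) \<and> pl x (mt y w) = mt (pl x y) (pl x w) \<and>
        tm x (jn y w) = jn (tm x y) (tm x w) \<and> tm x (mt y w) = mt (tm x y) (tm x w)) \<and>
     (\<forall>x\<in>A. \<forall>y\<in>A. \<forall>w\<in>A.
        \<comment> \<open>(E4)\<close>
        tm (pl x y) (pl (tm x y) w) = pl (tm x (pl y w)) (tm y w) \<and>
        \<comment> \<open>(E5)\<close>
        pl (tm x y) (tm (pl x y) w) = tm (pl x (tm y w)) (pl y w) \<and>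
        \<comment> \<open>(E6)\<close>
        pl (tm x y) w = jn (tm (pl x y) (pl (tm x y) w)) w \<and>
        \<comment> \<open>(E7)\<close>
        tm (pl x y) w = mt (pl (tm x y) (tm (pl x y) w)) w)"

definition cancellative ::
  "'a set \<Rightarrow> ('a \<Rightarrow> 'a \<Rightarrow> 'a) \<Rightarrow> ('a \<Rightarrow> 'a \<Rightarrow> 'a) \<Rightarrow> bool" where
  "cancellative A pl tm \<longleftrightarrow>
     (\<forall>x\<in>A. \<forall>y\<in>A. \<forall>w\<in>A. pl x w = pl y w \<and> tm x w = tm y w \<longrightarrow> x = y)"

end

theory Submission
  imports Defs
begin

text \<open>In an MV-algebra a case distinction along a chain is replaced by multiplication with two elements
  whose join is \<open>1\<close>, here \<open>\<not> (x \<odot> y)\<close> and \<open>x \<oplus> y\<close>; this gives (E4)--(E7).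

  Conversely, the elements of the positive cone of the enveloping lattice-ordered group are
  represented by good sequences. Adding an element \<open>a\<close> of the algebra sends
  \<open>s\<^sub>k\<close> to \<open>s\<^sub>k \<oplus> (a \<odot> s\<^bsub>k-1\<^esub>)\<close>. By (E4)--(E7) these
  operators preserve good sequences, commute and preserve meets, and by the quasi-identity they are
  injective. So good sequences form a cancellative commutative monoid in which addition
  distributes over meets, and the unit interval of its group of fractions is the required
  MV-algebra. Its cardinality is at most that of the lists over the algebra.\<close>

section \<open>Positive MV-algebras are MV-monoidal\<close>

text \<open>The construction is Chang's passage from an MV-algebra to a lattice-ordered group,
  carried out without negation. Three points shape it. Addition of good sequences is not given by a
  convolution formula: every good sequence is the sum of its own entries, so adding it means adding
  these one at a time, and the monoid laws reduce to the fact that two single additions commute. The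
  monoid of good sequences is equipped with meets only; subtraction and joins are expressed
  additively, the join of \<open>a\<close> and \<open>b\<close> as the element that gives
  \<open>a + b\<close> when the meet is added to it. Finally, an MV-algebra must live in a type
  named beforehand. A good sequence is a function on \<open>nat\<close>, but it is coded by a finite
  list, and pairs of lists over \<open>'a\<close> embed into \<open>'a + nat\<close>, which is
  infinite even if \<open>'a\<close> is finite.\<close>

locale mv_alg =
  fixes M :: "'b set" and pl (infixl "\<oplus>" 65) and tm (infixl "\<odot>" 70)
    and jn (infixl "\<squnion>" 62) and mt (infixl "\<sqinter>" 64)
    and ng ("\<sim> _" [81] 80) and z u
  assumes mv: "MV_algebra M pl tm jn mt ng z u"
begin

lemma closed [simp, intro]:
  "z \<in> M" "u \<in> M" "x \<in> M \<Longrightarrow> \<sim> x \<in> M"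
  "x \<in> M \<Longrightarrow> y \<in> M \<Longrightarrow> x \<oplus> y \<in> M" "x \<in> M \<Longrightarrow> y \<in> M \<Longrightarrow> x \<odot> y \<in> M"
  "x \<in> M \<Longrightarrow> y \<in> M \<Longrightarrow> x \<squnion> y \<in> M" "x \<in> M \<Longrightarrow> y \<in> M \<Longrightarrow> x \<sqinter> y \<in> M"
  using mv unfolding MV_algebra_def closed_alg_def by auto

lemma pl_assoc: "x \<in> M \<Longrightarrow> y \<in> M \<Longrightarrow> w \<in> M \<Longrightarrow> x \<oplus> y \<oplus> w = x \<oplus> (y \<oplus> w)"
  and pl_comm: "x \<in> M \<Longrightarrow> y \<in> M \<Longrightarrow> x \<oplus> y = y \<oplus> x"
  and pl_z [simp]: "x \<in> M \<Longrightarrow> x \<oplus> z = x"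
  and ng_ng [simp]: "x \<in> M \<Longrightarrow> \<sim> (\<sim> x) = x"
  and ng_z [simp]: "\<sim> z = u"
  and pl_u [simp]: "x \<in> M \<Longrightarrow> x \<oplus> u = u"
  and luk: "x \<in> M \<Longrightarrow> y \<in> M \<Longrightarrow> \<sim> (\<sim> x \<oplus> y) \<oplus> y = \<sim> (\<sim> y \<oplus> x) \<oplus> x"
  and tm_def: "x \<in> M \<Longrightarrow> y \<in> M \<Longrightarrow> x \<odot> y = \<sim> (\<sim> x \<oplus> \<sim> y)"
  and jn_def: "x \<in> M \<Longrightarrow> y \<in> M \<Longrightarrow> x \<squnion> y = x \<odot> \<sim> y \<oplus> y"
  and mt_def: "x \<in> M \<Longrightarrow> y \<in> M \<Longrightarrow> x \<sqinter> y = \<sim> (\<sim> x \<squnion> \<sim> y)"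
  using mv unfolding MV_algebra_def by auto

lemma ng_u [simp]: "\<sim> u = z"
  using ng_ng[of z] by simp

lemma z_pl [simp]: "x \<in> M \<Longrightarrow> z \<oplus> x = x"
  and u_pl [simp]: "x \<in> M \<Longrightarrow> u \<oplus> x = u"
  by (simp_all add: pl_comm[of z] pl_comm[of u])

lemma pl_left_comm: "x \<in> M \<Longrightarrow> y \<in> M \<Longrightarrow> w \<in> M \<Longrightarrow> x \<oplus> (y \<oplus> w) = y \<oplus> (x \<oplus> w)"
  by (metis pl_assoc pl_comm)

lemma tm_comm: "x \<in> M \<Longrightarrow> y \<in> M \<Longrightarrow> x \<odot> y = y \<odot> x"
  by (simp add: tm_def pl_comm)

lemma tm_assoc: "x \<in> M \<Longrightarrow> y \<in> M \<Longrightarrow> w \<in> M \<Longrightarrow> x \<odot> y \<odot> w = x \<odot> (y \<odot> w)"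
  by (simp add: tm_def pl_assoc)

lemma tm_left_comm: "x \<in> M \<Longrightarrow> y \<in> M \<Longrightarrow> w \<in> M \<Longrightarrow> x \<odot> (y \<odot> w) = y \<odot> (x \<odot> w)"
  by (metis tm_assoc tm_comm)

lemma tm_u [simp]: "x \<in> M \<Longrightarrow> x \<odot> u = x" "x \<in> M \<Longrightarrow> u \<odot> x = x"
  and tm_z [simp]: "x \<in> M \<Longrightarrow> x \<odot> z = z" "x \<in> M \<Longrightarrow> z \<odot> x = z"
  by (simp_all add: tm_def)

lemma ng_pl: "x \<in> M \<Longrightarrow> y \<in> M \<Longrightarrow> \<sim> (x \<oplus> y) = \<sim> x \<odot> \<sim> y"
  and ng_tm: "x \<in> M \<Longrightarrow> y \<in> M \<Longrightarrow> \<sim> (x \<odot> y) = \<sim> x \<oplus> \<sim> y"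
  and ng_jn: "x \<in> M \<Longrightarrow> y \<in> M \<Longrightarrow> \<sim> (x \<squnion> y) = \<sim> x \<sqinter> \<sim> y"
  and ng_mt: "x \<in> M \<Longrightarrow> y \<in> M \<Longrightarrow> \<sim> (x \<sqinter> y) = \<sim> x \<squnion> \<sim> y"
  by (simp_all add: tm_def mt_def)

lemma ng_inj: "x \<in> M \<Longrightarrow> y \<in> M \<Longrightarrow> \<sim> x = \<sim> y \<longleftrightarrow> x = y"
  by (metis ng_ng)

lemma ng_pl_self [simp]: "x \<in> M \<Longrightarrow> \<sim> x \<oplus> x = u"
  using luk[of x u] by simp

lemma ng_pl_left [simp]: "x \<in> M \<Longrightarrow> w \<in> M \<Longrightarrow> \<sim> x \<oplus> (x \<oplus> w) = u"
  by (simp add: pl_assoc[symmetric])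

lemma ng_tm_self [simp]: "x \<in> M \<Longrightarrow> x \<odot> \<sim> x = z"
  by (simp add: tm_def)

section \<open>Order, residuation and lattice structure of an MV-algebra\<close>

definition le (infix "\<preceq>" 50) where "x \<preceq> y \<longleftrightarrow> \<sim> x \<oplus> y = u"

lemma le_iff_pl:
  assumes "x \<in> M" "y \<in> M"
  shows "x \<preceq> y \<longleftrightarrow> x \<oplus> (y \<odot> \<sim> x) = y"
proof
  assume "x \<preceq> y"
  then show "x \<oplus> (y \<odot> \<sim> x) = y"
    using luk[of x y] assms by (simp add: le_def tm_def pl_comm)
next
  assume "x \<oplus> (y \<odot> \<sim> x) = y"
  then show "x \<preceq> y"
    using assms ng_pl_left[of x "y \<odot> \<sim> x"] by (simp add: le_def)
qed

lemma le_pl [simp]: "x \<in> M \<Longrightarrow> w \<in> M \<Longrightarrow> x \<preceq> x \<oplus> w" "x \<in> M \<Longrightarrow> w \<in> M \<Longrightarrow> x \<preceq> w \<oplus> x"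
proof -
  show "x \<preceq> x \<oplus> w" if "x \<in> M" "w \<in> M" for x w
    using that by (simp add: le_def)
  then show "x \<in> M \<Longrightarrow> w \<in> M \<Longrightarrow> x \<preceq> w \<oplus> x"
    by (metis pl_comm)
qed

lemma le_refl [simp]: "x \<in> M \<Longrightarrow> x \<preceq> x"
  by (simp add: le_def)

lemma le_trans: "x \<preceq> y \<Longrightarrow> y \<preceq> w \<Longrightarrow> x \<in> M \<Longrightarrow> y \<in> M \<Longrightarrow> w \<in> M \<Longrightarrow> x \<preceq> w"
  using le_pl(1)[of x "y \<odot> \<sim> x \<oplus> w \<odot> \<sim> y"] by (simp add: le_iff_pl pl_assoc[symmetric])

lemma le_antisym: "x \<preceq> y \<Longrightarrow> y \<preceq> x \<Longrightarrow> x \<in> M \<Longrightarrow> y \<in> M \<Longrightarrow> x = y"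
  using luk[of x y] by (simp add: le_def)

lemmas [trans] = le_trans

lemma ng_le: "x \<in> M \<Longrightarrow> y \<in> M \<Longrightarrow> \<sim> x \<preceq> \<sim> y \<longleftrightarrow> y \<preceq> x"
  by (simp add: le_def pl_comm)

lemma le_u [simp]: "x \<in> M \<Longrightarrow> x \<preceq> u" and z_le [simp]: "x \<in> M \<Longrightarrow> z \<preceq> x"
  by (simp_all add: le_def)

lemma pl_mono:
  assumes "x \<preceq> y" "x \<in> M" "y \<in> M" "w \<in> M"
  shows "w \<oplus> x \<preceq> w \<oplus> y"
  using assms le_pl(1)[of "w \<oplus> x" "y \<odot> \<sim> x"] by (simp add: le_iff_pl pl_assoc)

lemma tm_mono:
  assumes "x \<preceq> y" "x \<in> M" "y \<in> M" "w \<in> M"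
  shows "w \<odot> x \<preceq> w \<odot> y"
  using assms pl_mono[of "\<sim> y" "\<sim> x" "\<sim> w"] by (simp add: ng_le tm_def)

lemma pl_mono2:
  "x \<preceq> y \<Longrightarrow> x' \<preceq> y' \<Longrightarrow> x \<in> M \<Longrightarrow> y \<in> M \<Longrightarrow> x' \<in> M \<Longrightarrow> y' \<in> M \<Longrightarrow> x \<oplus> x' \<preceq> y \<oplus> y'"
  by (metis pl_mono pl_comm le_trans closed(4))

lemma tm_mono2:
  "x \<preceq> y \<Longrightarrow> x' \<preceq> y' \<Longrightarrow> x \<in> M \<Longrightarrow> y \<in> M \<Longrightarrow> x' \<in> M \<Longrightarrow> y' \<in> M \<Longrightarrow> x \<odot> x' \<preceq> y \<odot> y'"
  by (metis tm_mono tm_comm le_trans closed(5))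

lemma tm_le [simp]: "x \<in> M \<Longrightarrow> w \<in> M \<Longrightarrow> x \<odot> w \<preceq> x" "x \<in> M \<Longrightarrow> w \<in> M \<Longrightarrow> w \<odot> x \<preceq> x"
  using tm_mono[of w u x] by (simp_all add: tm_comm)

text \<open>Both sides unfold to the same sum being \<open>u\<close>. Multiplication by
  \<open>x\<close> is thus a left adjoint, which yields \<open>tm_jn\<close> and, by negation,
  \<open>pl_mt\<close>; the other two distributive laws are not formal and wait for
  \<open>prelinear\<close>.\<close>

lemma residuation:
  "x \<in> M \<Longrightarrow> y \<in> M \<Longrightarrow> w \<in> M \<Longrightarrow> x \<odot> y \<preceq> w \<longleftrightarrow> y \<preceq> \<sim> x \<oplus> w"
  by (simp add: le_def tm_def pl_assoc pl_left_comm)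

lemma jn_comm: "x \<in> M \<Longrightarrow> y \<in> M \<Longrightarrow> x \<squnion> y = y \<squnion> x"
  using luk[of x y] by (simp add: jn_def tm_def)

lemma mt_comm: "x \<in> M \<Longrightarrow> y \<in> M \<Longrightarrow> x \<sqinter> y = y \<sqinter> x"
  by (simp add: mt_def jn_comm)

lemma jn_ge [simp]: "x \<in> M \<Longrightarrow> y \<in> M \<Longrightarrow> y \<preceq> x \<squnion> y" "x \<in> M \<Longrightarrow> y \<in> M \<Longrightarrow> x \<preceq> x \<squnion> y"
proof -
  show "y \<preceq> x \<squnion> y" if "x \<in> M" "y \<in> M" for x y
    using that by (simp add: jn_def)
  then show "x \<in> M \<Longrightarrow> y \<in> M \<Longrightarrow> x \<preceq> x \<squnion> y"
    by (metis jn_comm)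
qed

lemma jn_least:
  assumes "x \<preceq> w" "y \<preceq> w" "x \<in> M" "y \<in> M" "w \<in> M"
  shows "x \<squnion> y \<preceq> w"
proof -
  have "y \<oplus> (\<sim> y \<odot> x) \<preceq> y \<oplus> (\<sim> y \<odot> w)"
    using assms by (intro pl_mono tm_mono) auto
  then show ?thesis
    using assms by (simp add: jn_def le_iff_pl[of y w] tm_comm pl_comm)
qed

lemma jn_le_iff: "x \<in> M \<Longrightarrow> y \<in> M \<Longrightarrow> w \<in> M \<Longrightarrow> x \<squnion> y \<preceq> w \<longleftrightarrow> x \<preceq> w \<and> y \<preceq> w"
  by (meson jn_least jn_ge le_trans closed(6))

lemma le_mt_iff: "x \<in> M \<Longrightarrow> y \<in> M \<Longrightarrow> w \<in> M \<Longrightarrow> w \<preceq> x \<sqinter> y \<longleftrightarrow> w \<preceq> x \<and> w \<preceq> y"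
  using jn_le_iff[of "\<sim> x" "\<sim> y" "\<sim> w"] ng_le[of "x \<sqinter> y" w] by (simp add: ng_mt ng_le)

lemma mt_le [simp]: "x \<in> M \<Longrightarrow> y \<in> M \<Longrightarrow> x \<sqinter> y \<preceq> x" "x \<in> M \<Longrightarrow> y \<in> M \<Longrightarrow> x \<sqinter> y \<preceq> y"
  using le_mt_iff[of x y "x \<sqinter> y"] by auto

lemma eq_above: "(\<And>w. w \<in> M \<Longrightarrow> x \<preceq> w \<longleftrightarrow> y \<preceq> w) \<Longrightarrow> x \<in> M \<Longrightarrow> y \<in> M \<Longrightarrow> x = y"
  by (meson le_antisym le_refl)

lemma eq_below: "(\<And>w. w \<in> M \<Longrightarrow> w \<preceq> x \<longleftrightarrow> w \<preceq> y) \<Longrightarrow> x \<in> M \<Longrightarrow> y \<in> M \<Longrightarrow> x = y"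
  by (meson le_antisym le_refl)

lemma jn_assoc: "x \<in> M \<Longrightarrow> y \<in> M \<Longrightarrow> w \<in> M \<Longrightarrow> x \<squnion> y \<squnion> w = x \<squnion> (y \<squnion> w)"
  by (rule eq_above) (auto simp: jn_le_iff)

lemma mt_assoc: "x \<in> M \<Longrightarrow> y \<in> M \<Longrightarrow> w \<in> M \<Longrightarrow> x \<sqinter> y \<sqinter> w = x \<sqinter> (y \<sqinter> w)"
  by (rule eq_below) (auto simp: le_mt_iff)

lemma absorption: "x \<in> M \<Longrightarrow> y \<in> M \<Longrightarrow> x \<squnion> (x \<sqinter> y) = x" "x \<in> M \<Longrightarrow> y \<in> M \<Longrightarrow> x \<sqinter> (x \<squnion> y) = x"
  by (auto intro!: le_antisym simp: jn_le_iff le_mt_iff)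

lemma tm_jn:
  assumes "x \<in> M" "y \<in> M" "w \<in> M"
  shows "x \<odot> (y \<squnion> w) = x \<odot> y \<squnion> x \<odot> w"
  by (rule eq_above) (use assms in \<open>auto simp: residuation jn_le_iff\<close>)

lemma pl_mt:
  assumes "x \<in> M" "y \<in> M" "w \<in> M"
  shows "x \<oplus> (y \<sqinter> w) = (x \<oplus> y) \<sqinter> (x \<oplus> w)"
  using tm_jn[of "\<sim> x" "\<sim> y" "\<sim> w"] assms
  by (subst ng_inj[symmetric]) (auto simp: ng_pl ng_mt)

lemma mt_eq: "x \<in> M \<Longrightarrow> y \<in> M \<Longrightarrow> x \<sqinter> y = y \<odot> (\<sim> y \<oplus> x)"
  by (simp add: mt_def jn_def tm_def pl_comm)

lemma jn_eq: "x \<in> M \<Longrightarrow> y \<in> M \<Longrightarrow> x \<squnion> y = y \<oplus> (\<sim> y \<odot> x)"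
  by (simp add: jn_def pl_comm tm_comm)

text \<open>The meet with \<open>y \<squnion> w\<close> is a product with the residual
  \<open>?c\<close>, and products distribute over joins. As \<open>\<sim> (y \<squnion> w)\<close>
  is below \<open>\<sim> y\<close> and \<open>\<sim> w\<close>, the two resulting products are below
  the two meets.\<close>

lemma mt_jn:
  assumes "x \<in> M" "y \<in> M" "w \<in> M"
  shows "x \<sqinter> (y \<squnion> w) = (x \<sqinter> y) \<squnion> (x \<sqinter> w)"
proof (rule le_antisym)
  let ?c = "\<sim> (y \<squnion> w) \<oplus> x"
  have c: "?c \<in> M" using assms by auto
  have y: "y \<odot> ?c \<preceq> y \<sqinter> x"
    using assms by (subst mt_comm) (auto simp: mt_eq intro!: tm_mono pl_mono2 simp: ng_le)
  have w: "w \<odot> ?c \<preceq> w \<sqinter> x"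
    using assms by (subst mt_comm) (auto simp: mt_eq intro!: tm_mono pl_mono2 simp: ng_le)
  have "x \<sqinter> (y \<squnion> w) = y \<odot> ?c \<squnion> w \<odot> ?c"
    using assms c by (simp add: mt_eq tm_jn tm_comm[of _ ?c])
  also have "\<dots> \<preceq> (x \<sqinter> y) \<squnion> (x \<sqinter> w)"
    using y w assms c
    by (auto simp: jn_le_iff mt_comm[of x] intro: le_trans[OF y] le_trans[OF w])
  finally show "x \<sqinter> (y \<squnion> w) \<preceq> (x \<sqinter> y) \<squnion> (x \<sqinter> w)" .
  show "(x \<sqinter> y) \<squnion> (x \<sqinter> w) \<preceq> x \<sqinter> (y \<squnion> w)"
    using assms by (auto simp: jn_le_iff le_mt_iff intro: le_trans[of _ y] le_trans[of _ w])
qed (use assms in auto)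

lemma jn_mt:
  assumes "x \<in> M" "y \<in> M" "w \<in> M"
  shows "x \<squnion> (y \<sqinter> w) = (x \<squnion> y) \<sqinter> (x \<squnion> w)"
  using mt_jn[of "\<sim> x" "\<sim> y" "\<sim> w"] assms
  by (subst ng_inj[symmetric]) (auto simp: ng_jn ng_mt)

text \<open>With \<open>m = x \<sqinter> y\<close> and \<open>d\<close> the meet of the two differences one has \<open>m \<oplus> d \<preceq> x \<sqinter> y = m\<close>
  and \<open>d \<preceq> \<sim> m\<close>, whence \<open>d = z\<close>.\<close>

lemma differences_disjoint:
  assumes "x \<in> M" "y \<in> M"
  shows "(x \<odot> \<sim> y) \<sqinter> (y \<odot> \<sim> x) = z"
proof -
  define m where "m = x \<sqinter> y"
  define d where "d = (x \<odot> \<sim> y) \<sqinter> (y \<odot> \<sim> x)"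
  have M: "m \<in> M" "d \<in> M" using assms by (auto simp: m_def d_def)
  have sub: "(x \<odot> \<sim> y) \<oplus> (x \<sqinter> y) = x" if "x \<in> M" "y \<in> M" for x y
  proof -
    have "x \<odot> \<sim> y \<oplus> (x \<odot> \<sim> (x \<odot> \<sim> y)) = x"
      using le_iff_pl[of "x \<odot> \<sim> y" x] that by simp
    then show ?thesis
      using that by (subst mt_comm) (simp_all add: mt_eq ng_tm)
  qed
  have "d \<oplus> m \<preceq> x"
    using pl_mono2[of d "x \<odot> \<sim> y" m m] sub[of x y] assms M by (simp add: d_def m_def)
  moreover have "d \<oplus> m \<preceq> y"
    using pl_mono2[of d "y \<odot> \<sim> x" m m] sub[of y x] assms M by (simp add: d_def m_def mt_comm)
  ultimately have "d \<oplus> m \<preceq> m"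
    using assms M by (simp add: m_def le_mt_iff)
  then have dm: "d \<oplus> m = m"
    using M by (intro le_antisym) auto
  have "d \<preceq> \<sim> y"
    using assms M by (auto simp: d_def intro: le_trans[of _ "x \<odot> \<sim> y"])
  then have "d \<preceq> \<sim> m"
    using assms M by (auto simp: m_def ng_le intro: le_trans[of _ "\<sim> y"])
  then have "d \<preceq> d \<sqinter> \<sim> m"
    using M by (simp add: le_mt_iff)
  also have "d \<sqinter> \<sim> m = \<sim> m \<odot> (d \<oplus> m)"
    using M by (simp add: mt_eq pl_comm)
  also have "\<dots> = z"
    using M by (simp add: dm tm_comm)
  finally show ?thesis
    using M by (auto intro!: le_antisym simp: d_def[symmetric])
qed

text \<open>De Morgan dual of \<open>differences_disjoint\<close>: the internal form of the
  statement that in a chain one of \<open>x \<preceq> y\<close> and \<open>y \<preceq> x\<close>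
  holds.\<close>

lemma prelinear: "x \<in> M \<Longrightarrow> y \<in> M \<Longrightarrow> (\<sim> x \<oplus> y) \<squnion> (\<sim> y \<oplus> x) = u"
  using differences_disjoint[of x y] by (subst ng_inj[symmetric]) (auto simp: ng_jn ng_pl)

text \<open>The equational substitute for a case distinction in a chain.\<close>

lemma le_by_cases:
  assumes "e \<squnion> f = u" "s \<odot> e \<preceq> t" "s \<odot> f \<preceq> t" "e \<in> M" "f \<in> M" "s \<in> M" "t \<in> M"
  shows "s \<preceq> t"
proof -
  have "s = s \<odot> e \<squnion> s \<odot> f"
    using assms by (simp add: tm_jn[symmetric])
  then show ?thesis
    using assms jn_le_iff[of "s \<odot> e" "s \<odot> f" t] by auto
qed

text \<open>Cases on which of \<open>y\<close> and \<open>w\<close> is smaller: multiplying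
  \<open>y\<close> by \<open>\<sim> y \<oplus> w\<close> gives exactly
  \<open>y \<sqinter> w\<close>.\<close>

lemma tm_mt:
  assumes "x \<in> M" "y \<in> M" "w \<in> M"
  shows "x \<odot> (y \<sqinter> w) = x \<odot> y \<sqinter> x \<odot> w"
proof (rule le_antisym)
  have key: "(x \<odot> y \<sqinter> x \<odot> w) \<odot> (\<sim> y \<oplus> w) \<preceq> x \<odot> (y \<sqinter> w)"
    if "x \<in> M" "y \<in> M" "w \<in> M" for x y w
  proof -
    have "(x \<odot> y \<sqinter> x \<odot> w) \<odot> (\<sim> y \<oplus> w) \<preceq> x \<odot> y \<odot> (\<sim> y \<oplus> w)"
      using that by (intro tm_mono2) auto
    then show ?thesis
      using that by (subst mt_comm[of y]) (simp_all add: mt_eq[of w y] tm_assoc)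
  qed
  show "x \<odot> y \<sqinter> x \<odot> w \<preceq> x \<odot> (y \<sqinter> w)"
    by (rule le_by_cases[OF prelinear[of y w]])
      (use assms key[of x y w] key[of x w y] in \<open>auto simp: mt_comm\<close>)
  show "x \<odot> (y \<sqinter> w) \<preceq> x \<odot> y \<sqinter> x \<odot> w"
    using assms by (auto simp: le_mt_iff intro!: tm_mono)
qed (use assms in auto)

lemma pl_jn:
  assumes "x \<in> M" "y \<in> M" "w \<in> M"
  shows "x \<oplus> (y \<squnion> w) = (x \<oplus> y) \<squnion> (x \<oplus> w)"
  using tm_mt[of "\<sim> x" "\<sim> y" "\<sim> w"] assms
  by (subst ng_inj[symmetric]) (auto simp: ng_pl ng_jn)

text \<open>Residuation gives \<open>y \<preceq> \<sim> x \<oplus> x \<odot> y\<close>; add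
  \<open>w\<close> and residuate back.\<close>

lemma linear_distrib:
  assumes "x \<in> M" "y \<in> M" "w \<in> M"
  shows "x \<odot> (y \<oplus> w) \<preceq> x \<odot> y \<oplus> w"
  using assms pl_mono2[of y "\<sim> x \<oplus> (x \<odot> y)" w w] residuation[of x y "x \<odot> y"]
  by (simp add: residuation pl_assoc)

text \<open>Prelinearity for \<open>x\<close> and \<open>\<sim> y\<close>. In a chain it says that
  \<open>x \<odot> y = z\<close> or \<open>x \<oplus> y = u\<close>.\<close>

lemma product_or_sum: "x \<in> M \<Longrightarrow> y \<in> M \<Longrightarrow> \<sim> (x \<odot> y) \<squnion> (x \<oplus> y) = u"
  using prelinear[of x "\<sim> y"] by (simp add: ng_tm pl_comm)

section \<open>The equations (E4)-(E7) and the quasi-identity in an MV-algebra\<close>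

lemma E6:
  assumes "x \<in> M" "y \<in> M" "w \<in> M"
  shows "x \<odot> y \<oplus> w = (x \<oplus> y) \<odot> (x \<odot> y \<oplus> w) \<squnion> w"
proof (rule le_antisym)
  let ?p = "x \<odot> y" and ?q = "x \<oplus> y"
  let ?r = "?q \<odot> (?p \<oplus> w) \<squnion> w"
  \<comment> \<open>Multiplying by \<open>\<sim> ?p\<close> takes the summand \<open>?p\<close> away
    again and leaves at most \<open>w\<close>; multiplying by \<open>?q\<close> instead gives the
    first joinand of \<open>?r\<close> itself.\<close>
  have "(?p \<oplus> w) \<odot> \<sim> ?p = w \<sqinter> \<sim> ?p"
    using assms by (simp add: mt_eq pl_comm tm_comm)
  also have "\<dots> \<preceq> ?r"
    using assms by (intro le_trans[of "w \<sqinter> \<sim> ?p" w ?r]) simp_all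
  finally have 1: "(?p \<oplus> w) \<odot> \<sim> ?p \<preceq> ?r" .
  have 2: "(?p \<oplus> w) \<odot> ?q \<preceq> ?r"
    using assms by (subst tm_comm) simp_all
  show "?p \<oplus> w \<preceq> ?r"
    using assms by (intro le_by_cases[OF product_or_sum[of x y] 1 2]) simp_all
  show "?r \<preceq> ?p \<oplus> w"
    using assms by (auto simp: jn_le_iff)
qed (use assms in auto)

lemma E7:
  assumes "x \<in> M" "y \<in> M" "w \<in> M"
  shows "(x \<oplus> y) \<odot> w = (x \<odot> y \<oplus> (x \<oplus> y) \<odot> w) \<sqinter> w"
  using E6[of "\<sim> x" "\<sim> y" "\<sim> w"] assms
  by (subst ng_inj[symmetric]) (auto simp: ng_mt ng_pl ng_tm)

text \<open>It turns each side of (E4) into the other side with \<open>x\<close> and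
  \<open>w\<close> interchanged, so that a single inequality, \<open>E4_le\<close>, suffices for
  (E4).\<close>

lemma product_sum_exchange:
  assumes "x \<in> M" "y \<in> M" "w \<in> M"
  shows "(x \<oplus> y) \<odot> (x \<odot> y \<oplus> w) = x \<odot> y \<oplus> (x \<oplus> y) \<odot> w"
proof (rule le_antisym)
  let ?p = "x \<odot> y" and ?q = "x \<oplus> y"
  show "?q \<odot> (?p \<oplus> w) \<preceq> ?p \<oplus> ?q \<odot> w"
    using assms linear_distrib[of ?q w ?p] by (simp add: pl_comm)
  have "(?p \<oplus> ?q \<odot> w) \<odot> \<sim> ?p = ?q \<odot> w \<sqinter> \<sim> ?p"
    using assms by (simp add: mt_eq pl_comm tm_comm)
  also have "\<dots> \<preceq> ?q \<odot> w"
    using assms by auto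
  finally have "(?p \<oplus> ?q \<odot> w) \<odot> \<sim> ?p \<preceq> ?q \<odot> w" .
  moreover have "?q \<odot> w \<preceq> ?q \<odot> (?p \<oplus> w)"
    using assms by (intro tm_mono) simp_all
  ultimately have 1: "(?p \<oplus> ?q \<odot> w) \<odot> \<sim> ?p \<preceq> ?q \<odot> (?p \<oplus> w)"
    by (rule le_trans) (use assms in simp_all)
  have 2: "(?p \<oplus> ?q \<odot> w) \<odot> ?q \<preceq> ?q \<odot> (?p \<oplus> w)"
    using assms by (subst tm_comm) (auto intro!: tm_mono pl_mono)
  show "?p \<oplus> ?q \<odot> w \<preceq> ?q \<odot> (?p \<oplus> w)"
    using assms by (intro le_by_cases[OF product_or_sum[of x y] 1 2]) auto
qed (use assms in auto)

text \<open>Two nested case distinctions, one by \<open>product_or_sum\<close> for \<open>x\<close>,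
  \<open>y\<close> and one for \<open>y\<close>, \<open>w\<close>. The facts \<open>11\<close>,
  \<open>12\<close>, \<open>21\<close>, \<open>22\<close> are the four cases; the first digit is 1
  for the factor \<open>\<sim> ?p\<close> and 2 for \<open>?q\<close>, the second likewise for
  \<open>\<sim> ?p'\<close> and \<open>?q'\<close>.\<close>

lemma E4_le:
  assumes M: "x \<in> M" "y \<in> M" "w \<in> M"
  shows "(x \<oplus> y) \<odot> (x \<odot> y \<oplus> w) \<preceq> x \<odot> (y \<oplus> w) \<oplus> y \<odot> w"
    (is "?s \<preceq> ?t")
proof -
  let ?p = "x \<odot> y" and ?q = "x \<oplus> y" and ?p' = "y \<odot> w" and ?q' = "y \<oplus> w"
  have q'x: "x \<odot> ?q' \<preceq> ?t"
    using M by simp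
  have s1: "?s \<odot> \<sim> ?p \<preceq> ?q \<odot> w"
  proof -
    have "?s \<odot> \<sim> ?p = ?q \<odot> (w \<sqinter> \<sim> ?p)"
      using M by (simp add: mt_eq pl_comm tm_comm tm_assoc tm_left_comm)
    also have "\<dots> \<preceq> ?q \<odot> w"
      using M by (intro tm_mono) auto
    finally show ?thesis .
  qed
  have 11: "?q \<odot> w \<odot> \<sim> ?p' \<preceq> ?t"
  proof -
    \<comment> \<open>Multiplication by \<open>\<sim> ?p'\<close> cuts \<open>w\<close> down to
      \<open>?v\<close>. Being below \<open>\<sim> y\<close>, it equals
      \<open>\<sim> y \<odot> (y \<oplus> ?v)\<close>, and the factor \<open>\<sim> y\<close> gained
      this way reduces \<open>?q\<close> to \<open>x \<sqinter> \<sim> y\<close>.\<close>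
    let ?v = "w \<sqinter> \<sim> y"
    have v: "?v \<in> M" "?v \<preceq> \<sim> y" "?v \<preceq> w"
      using M by auto
    have "w \<odot> \<sim> ?p' = ?v"
      using M by (subst mt_comm) (simp_all add: mt_eq ng_tm pl_comm)
    then have "?q \<odot> w \<odot> \<sim> ?p' = ?q \<odot> ?v"
      using M by (simp add: tm_assoc)
    also have "?v = ?v \<sqinter> \<sim> y"
      using M v le_trans[OF mt_le(1)[of ?v "\<sim> y"] v(3)] by (intro le_antisym) (simp_all add: le_mt_iff)
    also have "\<dots> = \<sim> y \<odot> (y \<oplus> ?v)"
      using M v(1) by (simp add: mt_eq[of _ "\<sim> y"] )
    also have "?q \<odot> (\<sim> y \<odot> (y \<oplus> ?v)) = (x \<sqinter> \<sim> y) \<odot> (y \<oplus> ?v)"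
      using M v(1) by (simp add: mt_eq[of x "\<sim> y"] pl_comm tm_comm tm_left_comm tm_assoc)
    also have "\<dots> \<preceq> x \<odot> ?q'"
      using M v by (intro tm_mono2 pl_mono) auto
    finally show ?thesis
      by (rule le_trans[OF _ q'x]) (use M in simp_all)
  qed
  have 12: "?q \<odot> w \<odot> ?q' \<preceq> ?t"
  proof -
    have "?q \<odot> w \<preceq> x \<oplus> ?p'"
      using M linear_distrib[of w y x] by (simp add: tm_comm pl_comm)
    then have "?q \<odot> w \<odot> ?q' \<preceq> (x \<oplus> ?p') \<odot> ?q'"
      using M by (intro tm_mono2) auto
    also have "\<dots> \<preceq> ?t"
      using M linear_distrib[of ?q' x ?p'] by (simp add: tm_comm)
    finally show ?thesis
      using M by simp
  qed
  \<comment> \<open>The factor \<open>\<sim> ?p'\<close> bounds the sum by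
    \<open>x \<squnion> \<sim> y\<close>, and \<open>?q\<close> times either joinand is below
    \<open>x\<close>.\<close>
  have s2: "(?p \<oplus> w) \<odot> ?q \<odot> \<sim> ?p' \<preceq> x"
  proof -
    have "(?p \<oplus> w) \<odot> \<sim> ?p' \<preceq> ?p \<oplus> w \<odot> \<sim> ?p'"
      using M linear_distrib[of "\<sim> ?p'" w ?p] by (simp add: tm_comm pl_comm)
    also have "w \<odot> \<sim> ?p' = \<sim> y \<sqinter> w"
      using M by (simp add: mt_eq ng_tm pl_comm)
    also have "?p \<oplus> (\<sim> y \<sqinter> w) \<preceq> ?p \<oplus> \<sim> y"
      using M by (intro pl_mono) auto
    also have "?p \<oplus> \<sim> y = x \<squnion> \<sim> y"
      using M by (simp add: jn_def)
    finally have "(?p \<oplus> w) \<odot> \<sim> ?p' \<odot> ?q \<preceq> (x \<squnion> \<sim> y) \<odot> ?q"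
      using M by (intro tm_mono2) simp_all
    also have "(x \<squnion> \<sim> y) \<odot> ?q = ?q \<odot> x \<squnion> ?q \<odot> \<sim> y"
      using M by (simp add: tm_comm[of _ ?q] tm_jn)
    also have "?q \<odot> \<sim> y = x \<sqinter> \<sim> y"
      using M by (simp add: mt_eq tm_comm pl_comm)
    also have "?q \<odot> x \<squnion> (x \<sqinter> \<sim> y) \<preceq> x"
      using M by (simp add: jn_le_iff)
    finally show ?thesis
      using M by (simp add: tm_comm tm_left_comm tm_assoc)
  qed
  have 21: "?s \<odot> ?q \<odot> \<sim> ?p' \<preceq> ?t"
  proof -
    \<comment> \<open>\<open>?y\<close> is the residual that writes
      \<open>x \<sqinter> (?p \<oplus> w)\<close> as a product with \<open>x\<close>. Of the two
      factors \<open>?q\<close>, one is spent in \<open>s2\<close>; the other brings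
      \<open>?y\<close> down below \<open>y\<close>.\<close>
    let ?y = "\<sim> x \<squnion> y"
    have y: "?y = \<sim> x \<oplus> ?p"
      using M by (subst jn_comm) (simp_all add: jn_eq)
    have "?s \<odot> ?q \<odot> \<sim> ?p' \<preceq> ?p \<oplus> w"
      using M by (simp add: tm_assoc tm_left_comm[of ?q "?p \<oplus> w"])
    moreover have "?s \<odot> ?q \<odot> \<sim> ?p' = ?q \<odot> ((?p \<oplus> w) \<odot> ?q \<odot> \<sim> ?p')"
      using M by (simp add: tm_assoc)
    ultimately have "(?p \<oplus> w) \<odot> ?q \<odot> \<sim> ?p' \<preceq> x \<sqinter> (?p \<oplus> w)"
      using M s2 by (simp add: le_mt_iff tm_assoc)
    then have "?s \<odot> ?q \<odot> \<sim> ?p' \<preceq> ?q \<odot> (x \<sqinter> (?p \<oplus> w))"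
      using M by (simp add: tm_assoc tm_mono)
    also have "x \<sqinter> (?p \<oplus> w) = x \<odot> (?y \<oplus> w)"
      using M by (subst mt_comm) (simp_all add: mt_eq y pl_assoc)
    also have "?q \<odot> (x \<odot> (?y \<oplus> w)) = x \<odot> (?q \<odot> (?y \<oplus> w))"
      using M by (simp add: tm_left_comm)
    also have "\<dots> \<preceq> x \<odot> (?q \<odot> ?y \<oplus> w)"
      using M linear_distrib[of ?q ?y w] by (intro tm_mono) auto
    also have "?q \<odot> ?y = (y \<sqinter> \<sim> x) \<squnion> ?q \<odot> y"
      using M by (simp add: tm_jn mt_eq tm_comm)
    also have "x \<odot> ((y \<sqinter> \<sim> x \<squnion> ?q \<odot> y) \<oplus> w) \<preceq> x \<odot> (y \<oplus> w)"
      using M by (intro tm_mono pl_mono2) (auto simp: jn_le_iff)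
    also note q'x
    finally show ?thesis
      using M by simp
  qed
  have 22: "?s \<odot> ?q \<odot> ?q' \<preceq> ?t"
  proof -
    have "w \<preceq> \<sim> y \<oplus> ?p'"
      using M residuation[of y w ?p'] by simp
    then have "?p \<oplus> w \<preceq> ?p \<oplus> (\<sim> y \<oplus> ?p')"
      using M by (intro pl_mono) auto
    also have "\<dots> = (x \<squnion> \<sim> y) \<oplus> ?p'"
      using M by (simp add: jn_def pl_assoc)
    finally have "?q \<odot> (?p \<oplus> w) \<preceq> ?q \<odot> ((x \<squnion> \<sim> y) \<oplus> ?p')"
      using M by (intro tm_mono) auto
    also have "\<dots> \<preceq> ?q \<odot> (x \<squnion> \<sim> y) \<oplus> ?p'"
      using M by (intro linear_distrib) auto
    also have "?q \<odot> (x \<squnion> \<sim> y) = ?q \<odot> x \<squnion> (x \<sqinter> \<sim> y)"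
      using M by (simp add: tm_jn mt_eq tm_comm pl_comm)
    also have "(?q \<odot> x \<squnion> (x \<sqinter> \<sim> y)) \<oplus> ?p' \<preceq> x \<oplus> ?p'"
      using M by (intro pl_mono2) (auto simp: jn_le_iff)
    finally have "?s \<odot> ?q' \<preceq> (x \<oplus> ?p') \<odot> ?q'"
      using M by (intro tm_mono2) simp_all
    also have "\<dots> \<preceq> ?t"
      using M linear_distrib[of ?q' x ?p'] by (simp add: tm_comm)
    finally have 1: "?s \<odot> ?q' \<preceq> ?t"
      using M by simp
    have 2: "?s \<odot> ?q \<odot> ?q' \<preceq> ?s \<odot> ?q'"
      by (rule tm_mono2) (use M in simp_all)
    show ?thesis
      by (rule le_trans[OF 2 1]) (use M in simp_all)
  qed
  have 1: "?s \<odot> \<sim> ?p \<preceq> ?t"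
  proof (rule le_by_cases[OF product_or_sum[of y w]])
    show "?s \<odot> \<sim> ?p \<odot> \<sim> ?p' \<preceq> ?t" "?s \<odot> \<sim> ?p \<odot> ?q' \<preceq> ?t"
      by (rule le_trans[OF tm_mono2[OF s1 le_refl] 11]; use M in simp)
        (rule le_trans[OF tm_mono2[OF s1 le_refl] 12]; use M in simp)
  qed (use M in auto)
  have 2: "?s \<odot> ?q \<preceq> ?t"
    using M by (intro le_by_cases[OF product_or_sum[of y w] 21 22]) auto
  show ?thesis
    using M by (intro le_by_cases[OF product_or_sum[of x y] 1 2]) auto
qed

lemma E4:
  assumes "x \<in> M" "y \<in> M" "w \<in> M"
  shows "(x \<oplus> y) \<odot> (x \<odot> y \<oplus> w) = x \<odot> (y \<oplus> w) \<oplus> y \<odot> w"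
  using assms E4_le[of x y w] E4_le[of w y x]
    product_sum_exchange[of x y w] product_sum_exchange[of w y x]
  by (intro le_antisym) (simp_all add: pl_comm tm_comm)

lemma E5:
  assumes "x \<in> M" "y \<in> M" "w \<in> M"
  shows "x \<odot> y \<oplus> (x \<oplus> y) \<odot> w = (x \<oplus> y \<odot> w) \<odot> (y \<oplus> w)"
  using assms E4[of w y x] by (simp add: pl_comm tm_comm)

lemma monoidal: "MV_monoidal M pl tm jn mt z u"
proof -
  have "closed_alg M pl tm jn mt z u"
    using mv by (simp add: MV_algebra_def)
  then show ?thesis
    unfolding MV_monoidal_def
    by (intro conjI ballI)
      (assumption | erule (2) jn_assoc mt_assoc mt_jn pl_assoc tm_assoc pl_jn pl_mt tm_jn tm_mt E4 E5 E6 E7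
        | erule (1) jn_comm mt_comm pl_comm tm_comm absorption | erule pl_z tm_u)+
qed

text \<open>The sum and the product with \<open>w\<close> determine the meet and the join with
  \<open>\<sim> w\<close>, and in a distributive lattice these two determine the element.\<close>

lemma cancellative: "cancellative M pl tm"
  unfolding cancellative_def
proof (intro ballI impI; elim conjE)
  fix x y w assume M: "x \<in> M" "y \<in> M" "w \<in> M" and eq: "x \<oplus> w = y \<oplus> w" "x \<odot> w = y \<odot> w"
  have m: "x \<sqinter> \<sim> w = y \<sqinter> \<sim> w" and j: "x \<squnion> \<sim> w = y \<squnion> \<sim> w"
    using M eq by (simp_all add: mt_eq jn_eq pl_comm tm_comm)
  have "x = x \<squnion> (x \<sqinter> \<sim> w)"
    using M by (simp add: absorption)
  also have "\<dots> = (x \<squnion> y) \<sqinter> (x \<squnion> \<sim> w)"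
    using M by (simp add: m jn_mt)
  also have "\<dots> = y \<squnion> (x \<sqinter> \<sim> w)"
    using M by (simp add: j jn_mt jn_comm[of x y])
  also have "\<dots> = y"
    using M by (simp add: m absorption)
  finally show "x = y" .
qed

end

section \<open>Pulling the equations and the quasi-identity back along the embedding\<close>

lemma positive_MV_imp_monoidal:
  assumes "positive_MV A pl tm jn mt z u TYPE('b)"
  shows "MV_monoidal A pl tm jn mt z u \<and> cancellative A pl tm"
proof -
  obtain M :: "'b set" and pl' tm' jn' mt' ng' z' u' h where
    mv: "MV_algebra M pl' tm' jn' mt' ng' z' u'"
    and emb: "pos_embedding h A pl tm jn mt z u M pl' tm' jn' mt' z' u'"
    and cl: "closed_alg A pl tm jn mt z u"
    using assms unfolding positive_MV_def by blast
  interpret mv_alg M pl' tm' jn' mt' ng' z' u'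
    by unfold_locales (rule mv)
  have [simp]: "z \<in> A" "u \<in> A" "x \<in> A \<Longrightarrow> y \<in> A \<Longrightarrow> pl x y \<in> A" "x \<in> A \<Longrightarrow> y \<in> A \<Longrightarrow> tm x y \<in> A"
    "x \<in> A \<Longrightarrow> y \<in> A \<Longrightarrow> jn x y \<in> A" "x \<in> A \<Longrightarrow> y \<in> A \<Longrightarrow> mt x y \<in> A" for x y
    using cl unfolding closed_alg_def by auto
  have [simp]: "h z = z'" "h u = u'" "x \<in> A \<Longrightarrow> h x \<in> M"
    "x \<in> A \<Longrightarrow> y \<in> A \<Longrightarrow> h (pl x y) = pl' (h x) (h y)"
    "x \<in> A \<Longrightarrow> y \<in> A \<Longrightarrow> h (tm x y) = tm' (h x) (h y)"
    "x \<in> A \<Longrightarrow> y \<in> A \<Longrightarrow> h (jn x y) = jn' (h x) (h y)"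
    "x \<in> A \<Longrightarrow> y \<in> A \<Longrightarrow> h (mt x y) = mt' (h x) (h y)" for x y
    using emb unfolding pos_embedding_def by auto
  have eqI: "x = y" if "h x = h y" "x \<in> A" "y \<in> A" for x y
    using emb that unfolding pos_embedding_def inj_on_def by auto
  have "cancellative A pl tm"
    unfolding cancellative_def
  proof (intro ballI impI; elim conjE)
    fix x y w assume "x \<in> A" "y \<in> A" "w \<in> A" "pl x w = pl y w" "tm x w = tm y w"
    note A = this
    have "h (pl x w) = h (pl y w)" "h (tm x w) = h (tm y w)"
      using A by simp_all
    then have "h x = h y"
      by (intro cancellative[unfolded cancellative_def, rule_format, of "h x" "h y" "h w"])
        (use A(1-3) in simp_all)
    then show "x = y"
      using A(1,2) by (rule eqI)
  qed
  moreover have "MV_monoidal A pl tm jn mt z u"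
    unfolding MV_monoidal_def
    by (intro conjI ballI cl; rule eqI;
        (simp; (rule jn_assoc mt_assoc jn_comm mt_comm absorption mt_jn pl_assoc tm_assoc
          pl_comm tm_comm pl_jn pl_mt tm_jn tm_mt E4 E5 E6 E7; simp)?))
  ultimately show ?thesis by blast
qed

section \<open>The unit interval of a group of fractions\<close>

text \<open>An infinite type contains its own square. The pairing \<open>g\<close> codes lists
  recursively, with the tags \<open>a\<close> and \<open>b\<close> separating the empty list from
  the others.\<close>

lemma ex_inj_list:
  includes cardinal_syntax
  assumes "infinite (UNIV :: 'b set)"
  shows "\<exists>f :: 'b list \<Rightarrow> 'b. inj f"
proof -
  have "|UNIV \<times> UNIV :: ('b \<times> 'b) set| \<le>o |UNIV :: 'b set|"
    using card_of_Times_same_infinite[OF assms] ordIso_iff_ordLeq by blast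
  then obtain g :: "'b \<times> 'b \<Rightarrow> 'b" where g: "inj g"
    unfolding card_of_ordLeq[symmetric] by auto
  obtain a b :: 'b where "a \<noteq> b"
    using assms by (metis UNIV_I finite.emptyI finite.insertI finite_subset insertCI subsetI)
  define f where "f = rec_list (g (a, a)) (\<lambda>x _ y. g (b, g (x, y)))"
  have "inj f"
  proof (rule injI)
    show "f xs = f ys \<Longrightarrow> xs = ys" for xs ys
    proof (induction xs arbitrary: ys)
      case Nil
      then show ?case
        using g \<open>a \<noteq> b\<close> by (cases ys) (auto simp: f_def dest: injD)
    next
      case (Cons x xs)
      then show ?case
        using g \<open>a \<noteq> b\<close> by (cases ys) (auto simp: f_def dest!: injD[OF g])
    qed
  qed
  then show ?thesis by blast
qed

text \<open>The summand \<open>nat\<close> makes the type infinite and also supplies the separator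
  \<open>Inr 0\<close>, which cannot occur inside either list.\<close>

lemma ex_inj_list_pair: "\<exists>f :: 'a list \<times> 'a list \<Rightarrow> 'a + nat. inj f"
proof -
  have "infinite (UNIV :: ('a + nat) set)"
    by simp
  then obtain f :: "('a + nat) list \<Rightarrow> 'a + nat" where f: "inj f"
    using ex_inj_list by blast
  define g where "g = (\<lambda>(xs, ys). f (map Inl xs @ Inr 0 # map Inl ys :: ('a + nat) list))"
  have *: "xs = xs' \<and> ys = ys'"
    if "map Inl xs @ Inr 0 # map Inl ys = (map Inl xs' @ Inr 0 # map Inl ys' :: ('a + nat) list)"
    for xs ys xs' ys'
    using that
  proof (induction xs arbitrary: xs')
    case Nil
    then show ?case by (cases xs') (auto simp: inj_map_eq_map)
  next
    case (Cons x xs)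
    then show ?case by (cases xs') auto
  qed
  have "inj g"
    using * by (auto simp: g_def inj_def dest!: injD[OF f])
  then show ?thesis by blast
qed

text \<open>The pair \<open>(p, q)\<close> stands for the difference \<open>p - q\<close> in the group of fractions.
  Only the differences between \<open>0\<close> and \<open>1\<close> are kept; \<open>code\<close> encodes the pairs
  in the type that is to carry the MV-algebra.\<close>

locale unital_cancel_monoid =
  fixes P :: "'c set" and add (infixl "\<^bold>+" 65) and inf (infixl "\<^bold>\<and>" 64)
    and zero ("\<^bold>0") and one ("\<^bold>1") and code :: "'c \<times> 'c \<Rightarrow> 'd"
  assumes zero_closed [simp]: "\<^bold>0 \<in> P" and one_closed [simp]: "\<^bold>1 \<in> P"
    and add_closed [simp]: "p \<in> P \<Longrightarrow> q \<in> P \<Longrightarrow> p \<^bold>+ q \<in> P"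
    and inf_closed [simp]: "p \<in> P \<Longrightarrow> q \<in> P \<Longrightarrow> p \<^bold>\<and> q \<in> P"
    and add_assoc: "p \<in> P \<Longrightarrow> q \<in> P \<Longrightarrow> r \<in> P \<Longrightarrow> p \<^bold>+ q \<^bold>+ r = p \<^bold>+ (q \<^bold>+ r)"
    and add_comm: "p \<in> P \<Longrightarrow> q \<in> P \<Longrightarrow> p \<^bold>+ q = q \<^bold>+ p"
    and add_zero [simp]: "p \<in> P \<Longrightarrow> p \<^bold>+ \<^bold>0 = p"
    and add_cancel: "p \<in> P \<Longrightarrow> q \<in> P \<Longrightarrow> r \<in> P \<Longrightarrow> r \<^bold>+ p = r \<^bold>+ q \<Longrightarrow> p = q"
    and inf_assoc: "p \<in> P \<Longrightarrow> q \<in> P \<Longrightarrow> r \<in> P \<Longrightarrow> p \<^bold>\<and> q \<^bold>\<and> r = p \<^bold>\<and> (q \<^bold>\<and> r)"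
    and inf_comm: "p \<in> P \<Longrightarrow> q \<in> P \<Longrightarrow> p \<^bold>\<and> q = q \<^bold>\<and> p"
    and inf_idem [simp]: "p \<in> P \<Longrightarrow> p \<^bold>\<and> p = p"
    and add_inf: "p \<in> P \<Longrightarrow> q \<in> P \<Longrightarrow> r \<in> P \<Longrightarrow> p \<^bold>+ (q \<^bold>\<and> r) = (p \<^bold>+ q) \<^bold>\<and> (p \<^bold>+ r)"
    and zero_inf_one: "\<^bold>0 \<^bold>\<and> \<^bold>1 = \<^bold>0"
    and code_inj: "inj_on code (P \<times> P)"
begin

lemma add_left_comm: "p \<in> P \<Longrightarrow> q \<in> P \<Longrightarrow> r \<in> P \<Longrightarrow> p \<^bold>+ (q \<^bold>+ r) = q \<^bold>+ (p \<^bold>+ r)"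
  by (metis add_assoc add_comm)

lemma zero_add [simp]: "p \<in> P \<Longrightarrow> \<^bold>0 \<^bold>+ p = p"
  by (simp add: add_comm[of "\<^bold>0"])

lemma inf_add: "p \<in> P \<Longrightarrow> q \<in> P \<Longrightarrow> r \<in> P \<Longrightarrow> (q \<^bold>\<and> r) \<^bold>+ p = (q \<^bold>+ p) \<^bold>\<and> (r \<^bold>+ p)"
  by (simp add: add_inf add_comm[of _ p])

section \<open>Differences between 0 and 1 and their truncated arithmetic\<close>

definition D where "D = {(p, q). p \<in> P \<and> q \<in> P \<and> q \<^bold>\<and> p = q \<and> p \<^bold>\<and> (q \<^bold>+ \<^bold>1) = p}"

fun equ (infix "\<approx>" 50) where "(p, q) \<approx> (p', q') \<longleftrightarrow> p \<^bold>+ q' = p' \<^bold>+ q"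

text \<open>The sum of two differences cut off at 1. Over the subtrahend \<open>q + q'\<close> the
  bound 1 has the minuend \<open>q + q' + 1\<close>.\<close>

fun plus (infixl "\<^bold>\<oplus>" 65) where
  "(p, q) \<^bold>\<oplus> (p', q') = ((p \<^bold>+ p') \<^bold>\<and> (q \<^bold>+ q' \<^bold>+ \<^bold>1), q \<^bold>+ q')"

fun neg where "neg (p, q) = (q \<^bold>+ \<^bold>1, p)"

lemma D_iff: "(p, q) \<in> D \<longleftrightarrow> p \<in> P \<and> q \<in> P \<and> q \<^bold>\<and> p = q \<and> p \<^bold>\<and> (q \<^bold>+ \<^bold>1) = p"
  by (simp add: D_def)

text \<open>Monotonicity of addition; the order has no symbol here and is expressed by a meet being
  equal to its first argument.\<close>

lemma inf_add_mono:
  assumes "p \<^bold>\<and> q = p" "p' \<^bold>\<and> q' = p'" "p \<in> P" "q \<in> P" "p' \<in> P" "q' \<in> P"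
  shows "(p \<^bold>+ p') \<^bold>\<and> (q \<^bold>+ q') = p \<^bold>+ p'"
proof -
  have a: "(p \<^bold>+ p') \<^bold>\<and> (p \<^bold>+ q') = p \<^bold>+ p'"
    using assms add_inf[of p p' q'] by simp
  have b: "(p \<^bold>+ q') \<^bold>\<and> (q \<^bold>+ q') = p \<^bold>+ q'"
    using assms inf_add[of q' p q] by simp
  have "(p \<^bold>+ p') \<^bold>\<and> (q \<^bold>+ q') = (p \<^bold>+ p') \<^bold>\<and> ((p \<^bold>+ q') \<^bold>\<and> (q \<^bold>+ q'))"
    using assms(3-) inf_assoc[of "p \<^bold>+ p'" "p \<^bold>+ q'" "q \<^bold>+ q'"] by (simp add: a)
  then show ?thesis
    by (simp add: a b)
qed

lemma le_add_one: "p \<in> P \<Longrightarrow> p \<^bold>\<and> (p \<^bold>+ \<^bold>1) = p"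
  using inf_add_mono[of p p "\<^bold>0" "\<^bold>1"] by (simp add: zero_inf_one)

lemma neg_D: "x \<in> D \<Longrightarrow> neg x \<in> D"
  by (cases x) (auto simp: D_iff intro: inf_add_mono)

lemma plus_D: "x \<in> D \<Longrightarrow> y \<in> D \<Longrightarrow> x \<^bold>\<oplus> y \<in> D"
proof (cases x, cases y)
  fix p q p' q' assume x: "x \<in> D" "x = (p, q)" and y: "y \<in> D" "y = (p', q')"
  have "(q \<^bold>+ q') \<^bold>\<and> (p \<^bold>+ p') = q \<^bold>+ q'"
    using x y by (intro inf_add_mono) (auto simp: D_iff)
  then have "(q \<^bold>+ q') \<^bold>\<and> ((p \<^bold>+ p') \<^bold>\<and> (q \<^bold>+ q' \<^bold>+ \<^bold>1)) = (q \<^bold>+ q') \<^bold>\<and> (q \<^bold>+ q' \<^bold>+ \<^bold>1)"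
    using x y by (simp add: D_iff inf_assoc[symmetric])
  then show ?thesis
    using x y by (simp add: D_iff le_add_one inf_assoc)
qed

text \<open>An inner truncation at \<open>b\<close> is absorbed by the outer one: after adding
  \<open>p\<close>, the inner bound becomes \<open>b + p\<close>, which lies above the outer bound
  \<open>b + q\<close> because \<open>q\<close> is below \<open>p\<close>.\<close>

lemma plus_assoc:
  assumes "x \<in> D" "y \<in> D" "w \<in> D"
  shows "x \<^bold>\<oplus> y \<^bold>\<oplus> w = x \<^bold>\<oplus> (y \<^bold>\<oplus> w)"
proof -
  obtain p q p' q' p'' q'' where xyw: "x = (p, q)" "y = (p', q')" "w = (p'', q'')"
    by (metis surj_pair)
  have absorb: "((a \<^bold>\<and> b) \<^bold>+ p) \<^bold>\<and> (b \<^bold>+ q) = (a \<^bold>+ p) \<^bold>\<and> (b \<^bold>+ q)"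
    if "(p, q) \<in> D" "a \<in> P" "b \<in> P" for a b p q
  proof -
    have "(b \<^bold>+ p) \<^bold>\<and> (b \<^bold>+ q) = b \<^bold>+ q"
      using that add_inf[of b p q] by (simp add: D_iff inf_comm[of p])
    then show ?thesis
      using that by (simp add: D_iff inf_add inf_assoc)
  qed
  have 1: "(((p \<^bold>+ p') \<^bold>\<and> (q \<^bold>+ q' \<^bold>+ \<^bold>1)) \<^bold>+ p'') \<^bold>\<and> (q \<^bold>+ q' \<^bold>+ \<^bold>1 \<^bold>+ q'')
      = (p \<^bold>+ p' \<^bold>+ p'') \<^bold>\<and> (q \<^bold>+ q' \<^bold>+ \<^bold>1 \<^bold>+ q'')"
    by (rule absorb) (use assms in \<open>simp_all add: xyw D_iff\<close>)
  have 2: "(((p' \<^bold>+ p'') \<^bold>\<and> (q' \<^bold>+ q'' \<^bold>+ \<^bold>1)) \<^bold>+ p) \<^bold>\<and> (q' \<^bold>+ q'' \<^bold>+ \<^bold>1 \<^bold>+ q)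
      = (p' \<^bold>+ p'' \<^bold>+ p) \<^bold>\<and> (q' \<^bold>+ q'' \<^bold>+ \<^bold>1 \<^bold>+ q)"
    by (rule absorb) (use assms in \<open>simp_all add: xyw D_iff\<close>)
  have P: "p \<in> P" "q \<in> P" "p' \<in> P" "q' \<in> P" "p'' \<in> P" "q'' \<in> P"
    using assms by (auto simp: xyw D_iff)
  show ?thesis
    using 1 2 P by (simp add: xyw add_assoc add_comm add_left_comm)
qed

lemma plus_comm: "x \<in> D \<Longrightarrow> y \<in> D \<Longrightarrow> x \<^bold>\<oplus> y = y \<^bold>\<oplus> x"
  by (cases x; cases y) (simp add: D_iff add_comm)

lemma equ_plus_comm: "x \<in> D \<Longrightarrow> y \<in> D \<Longrightarrow> x \<^bold>\<oplus> y \<approx> y \<^bold>\<oplus> x"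
  by (cases x; cases y) (auto simp: D_iff add_comm)

lemma plus_zero: "x \<in> D \<Longrightarrow> x \<^bold>\<oplus> (\<^bold>0, \<^bold>0) = x"
  by (cases x) (simp add: D_iff)

lemma plus_one: "x \<in> D \<Longrightarrow> x \<^bold>\<oplus> neg (\<^bold>0, \<^bold>0) \<approx> neg (\<^bold>0, \<^bold>0)"
  by (cases x) (auto simp: D_iff inf_add[symmetric] inf_comm add_comm[of "\<^bold>1"])

lemma neg_neg: "x \<in> D \<Longrightarrow> neg (neg x) \<approx> x"
  by (cases x) (auto simp: D_iff add_assoc add_comm add_left_comm)

text \<open>The term that defines the join in an MV-algebra, computed on differences. Exchanging the
  two differences leaves \<open>m\<close> unchanged, and this symmetry gives
  \<open>lukasiewicz\<close>.\<close>

lemma neg_plus_join: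
  assumes "(p, q) \<in> D" "(p', q') \<in> D"
    and m: "m = (p \<^bold>+ q' \<^bold>+ \<^bold>1) \<^bold>\<and> (p' \<^bold>+ q \<^bold>+ \<^bold>1)"
  shows "neg (neg (p, q) \<^bold>\<oplus> (p', q')) \<^bold>\<oplus> (p', q')
    = ((p \<^bold>+ q' \<^bold>+ \<^bold>1 \<^bold>+ p') \<^bold>\<and> (m \<^bold>+ q' \<^bold>+ \<^bold>1), m \<^bold>+ q')"
  using assms(1,2) by (simp add: D_iff m add_assoc add_comm add_left_comm inf_comm)

lemma lukasiewicz:
  assumes "x \<in> D" "y \<in> D"
  shows "neg (neg x \<^bold>\<oplus> y) \<^bold>\<oplus> y \<approx> neg (neg y \<^bold>\<oplus> x) \<^bold>\<oplus> x"
proof -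
  obtain p q p' q' where xy: "x = (p, q)" "y = (p', q')"
    by (metis surj_pair)
  define m where "m = (p \<^bold>+ q' \<^bold>+ \<^bold>1) \<^bold>\<and> (p' \<^bold>+ q \<^bold>+ \<^bold>1)"
  have P: "p \<in> P" "q \<in> P" "p' \<in> P" "q' \<in> P"
    using assms by (auto simp: xy D_iff)
  then have M: "m \<in> P" and m': "m = (p' \<^bold>+ q \<^bold>+ \<^bold>1) \<^bold>\<and> (p \<^bold>+ q' \<^bold>+ \<^bold>1)"
    by (simp_all add: m_def inf_comm)
  show ?thesis
    using assms P M unfolding xy
    by (simp only: neg_plus_join[OF _ _ m_def] neg_plus_join[OF _ _ m'])
      (simp add: inf_add add_inf add_assoc add_comm add_left_comm)
qed

lemma equ_refl: "x \<approx> x"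
  by (cases x) simp

lemma equ_sym: "x \<approx> y \<Longrightarrow> y \<approx> x"
  by (cases x; cases y) simp

text \<open>Cancellativity of the monoid enters here, to remove the middle subtrahend
  \<open>q'\<close>.\<close>

lemma equ_trans:
  assumes "x \<approx> y" "y \<approx> w" "x \<in> D" "y \<in> D" "w \<in> D"
  shows "x \<approx> w"
proof -
  obtain p q p' q' p'' q'' where xyw: "x = (p, q)" "y = (p', q')" "w = (p'', q'')"
    by (metis surj_pair)
  have P: "p \<in> P" "q \<in> P" "p' \<in> P" "q' \<in> P" "p'' \<in> P" "q'' \<in> P"
    using assms by (auto simp: xyw D_iff)
  have "q' \<^bold>+ (p \<^bold>+ q'') = (p \<^bold>+ q') \<^bold>+ q''"
    using P by (simp add: add_assoc add_comm add_left_comm)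
  also have "\<dots> = (p' \<^bold>+ q'') \<^bold>+ q"
    using assms(1) P by (simp add: xyw add_assoc add_comm add_left_comm)
  also have "\<dots> = q' \<^bold>+ (p'' \<^bold>+ q)"
    using assms(2) P by (simp add: xyw add_assoc add_comm add_left_comm)
  finally show ?thesis
    using P by (auto simp: xyw intro: add_cancel[of _ _ q'])
qed

lemma neg_cong: "x \<approx> y \<Longrightarrow> x \<in> D \<Longrightarrow> y \<in> D \<Longrightarrow> neg x \<approx> neg y"
proof (cases x; cases y)
  fix p q p' q' assume xy: "x = (p, q)" "y = (p', q')" and *: "x \<approx> y" "x \<in> D" "y \<in> D"
  then have P: "p \<in> P" "q \<in> P" "p' \<in> P" "q' \<in> P"
    by (auto simp: D_iff)
  have "q \<^bold>+ \<^bold>1 \<^bold>+ p' = p' \<^bold>+ q \<^bold>+ \<^bold>1"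
    using P by (simp add: add_assoc add_comm add_left_comm)
  also have "\<dots> = p \<^bold>+ q' \<^bold>+ \<^bold>1"
    using * by (simp add: xy)
  also have "\<dots> = q' \<^bold>+ \<^bold>1 \<^bold>+ p"
    using P by (simp add: add_assoc add_comm add_left_comm)
  finally show ?thesis
    by (simp add: xy)
qed

lemma plus_cong:
  assumes "x \<approx> x'" "y \<approx> y'" "x \<in> D" "y \<in> D" "x' \<in> D" "y' \<in> D"
  shows "x \<^bold>\<oplus> y \<approx> x' \<^bold>\<oplus> y'"
proof -
  have *: "x \<^bold>\<oplus> y \<approx> x' \<^bold>\<oplus> y" if "x \<approx> x'" "x \<in> D" "x' \<in> D" "y \<in> D" for x x' y
  proof -
    obtain p q p' q' a b where xy: "x = (p, q)" "x' = (p', q')" "y = (a, b)"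
      by (metis surj_pair)
    have P: "p \<in> P" "q \<in> P" "p' \<in> P" "q' \<in> P" "a \<in> P" "b \<in> P"
      using that by (auto simp: xy D_iff)
    have "p \<^bold>+ a \<^bold>+ (q' \<^bold>+ b) = (p \<^bold>+ q') \<^bold>+ (a \<^bold>+ b)"
      using P by (simp add: add_assoc add_comm add_left_comm)
    also have "\<dots> = (p' \<^bold>+ q) \<^bold>+ (a \<^bold>+ b)"
      using that by (simp add: xy)
    also have "\<dots> = p' \<^bold>+ a \<^bold>+ (q \<^bold>+ b)"
      using P by (simp add: add_assoc add_comm add_left_comm)
    finally have "p \<^bold>+ a \<^bold>+ (q' \<^bold>+ b) = p' \<^bold>+ a \<^bold>+ (q \<^bold>+ b)" .
    moreover have "q \<^bold>+ b \<^bold>+ \<^bold>1 \<^bold>+ (q' \<^bold>+ b) = q' \<^bold>+ b \<^bold>+ \<^bold>1 \<^bold>+ (q \<^bold>+ b)"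
      using P by (simp add: add_assoc add_comm add_left_comm)
    ultimately show ?thesis
      using P by (simp add: xy inf_add)
  qed
  have "x' \<^bold>\<oplus> y \<approx> x' \<^bold>\<oplus> y'"
    using *[of y y' x'] assms by (simp add: plus_comm[of x'])
  then show ?thesis
    using equ_trans[OF *[of x x' y]] assms by (simp add: plus_D)
qed

text \<open>A class is represented by the code of a chosen member rather than by a set of pairs, so
  that the carrier lies in the type \<open>'d\<close>. Equivalent pairs define the same predicate
  under \<open>SOME\<close>, hence the same choice.\<close>

definition cls where "cls d = code (SOME e. e \<in> D \<and> e \<approx> d)"

lemma cls_eq_iff:
  assumes "d \<in> D" "e \<in> D"
  shows "cls d = cls e \<longleftrightarrow> d \<approx> e"
proof
  let ?r = "\<lambda>d. SOME e. e \<in> D \<and> e \<approx> d"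
  have r: "?r d \<in> D" "?r d \<approx> d" if "d \<in> D" for d
    using someI[of "\<lambda>e. e \<in> D \<and> e \<approx> d" d] that equ_refl by blast+
  have "inj_on code D"
    using code_inj by (rule inj_on_subset) (auto simp: D_def)
  then show "d \<approx> e" if "cls d = cls e"
  proof -
    have "?r d = ?r e"
      using \<open>inj_on code D\<close> that r(1)[OF assms(1)] r(1)[OF assms(2)]
      unfolding cls_def by (rule inj_onD)
    then have "?r d \<approx> e"
      using r(2)[OF assms(2)] by simp
    then show ?thesis
      using equ_trans[OF equ_sym[OF r(2)[OF assms(1)]]] r(1)[OF assms(1)] assms by blast
  qed
  assume "d \<approx> e"
  then have "f \<in> D \<and> f \<approx> d \<longleftrightarrow> f \<in> D \<and> f \<approx> e" for f
    using assms equ_trans[of f d e] equ_trans[of f e d] equ_sym[of d e] by blast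
  then show "cls d = cls e"
    by (simp add: cls_def)
qed

section \<open>The MV-algebra of classes\<close>

abbreviation "rep \<equiv> inv_into D cls"

definition "mv_pl x y = cls (rep x \<^bold>\<oplus> rep y)"
definition "mv_ng x = cls (neg (rep x))"
definition "mv_tm x y = mv_ng (mv_pl (mv_ng x) (mv_ng y))"
definition "mv_jn x y = mv_pl (mv_tm x (mv_ng y)) y"
definition "mv_mt x y = mv_ng (mv_jn (mv_ng x) (mv_ng y))"

lemma rep_cls:
  assumes "d \<in> D"
  shows "rep (cls d) \<in> D" "rep (cls d) \<approx> d"
proof -
  have "cls d \<in> cls ` D"
    using assms by simp
  then have "rep (cls d) \<in> D" "cls (rep (cls d)) = cls d"
    by (simp_all only: inv_into_into f_inv_into_f)
  then show "rep (cls d) \<in> D" "rep (cls d) \<approx> d"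
    using cls_eq_iff[OF _ assms, of "rep (cls d)"] by simp_all
qed

lemma mv_pl_cls:
  assumes "d \<in> D" "e \<in> D"
  shows "mv_pl (cls d) (cls e) = cls (d \<^bold>\<oplus> e)"
proof -
  have "rep (cls d) \<^bold>\<oplus> rep (cls e) \<approx> d \<^bold>\<oplus> e"
    using assms by (intro plus_cong rep_cls)
  then show ?thesis
    unfolding mv_pl_def using assms by (intro cls_eq_iff[THEN iffD2] plus_D rep_cls)
qed

lemma mv_ng_cls:
  assumes "d \<in> D"
  shows "mv_ng (cls d) = cls (neg d)"
proof -
  have "neg (rep (cls d)) \<approx> neg d"
    using assms by (intro neg_cong rep_cls)
  then show ?thesis
    unfolding mv_ng_def using assms by (intro cls_eq_iff[THEN iffD2] neg_D rep_cls)
qed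

lemma zero_D [simp]: "(\<^bold>0, \<^bold>0) \<in> D"
  by (simp add: D_iff zero_inf_one)

lemmas mv_cls = mv_pl_cls mv_ng_cls neg_D plus_D

lemma mv_ng_ng: "d \<in> D \<Longrightarrow> mv_ng (mv_ng (cls d)) = cls d"
  by (simp add: mv_cls cls_eq_iff neg_neg)

lemma mv_jn_cls: "d \<in> D \<Longrightarrow> e \<in> D \<Longrightarrow> mv_jn (cls d) (cls e) = cls (neg (neg d \<^bold>\<oplus> e) \<^bold>\<oplus> e)"
  by (simp add: mv_jn_def mv_tm_def mv_ng_ng) (simp add: mv_cls)

lemma MV_algebra_cls:
  "MV_algebra (cls ` D) mv_pl mv_tm mv_jn mv_mt mv_ng (cls (\<^bold>0, \<^bold>0)) (cls (\<^bold>1, \<^bold>0))"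
proof -
  have "cls (\<^bold>1, \<^bold>0) = mv_ng (cls (\<^bold>0, \<^bold>0))"
    by (simp add: mv_ng_cls)
  then show ?thesis
    unfolding MV_algebra_def closed_alg_def
    by (auto simp: mv_tm_def[abs_def] mv_jn_def[abs_def] mv_mt_def[abs_def] mv_cls plus_assoc plus_zero
        cls_eq_iff neg_neg lukasiewicz plus_one simp del: neg.simps plus.simps
        intro: equ_plus_comm)
qed

section \<open>The MV-operations on elements of the monoid between 0 and 1\<close>

lemma unit_interval_D: "a \<in> P \<Longrightarrow> \<^bold>0 \<^bold>\<and> a = \<^bold>0 \<Longrightarrow> a \<^bold>\<and> \<^bold>1 = a \<Longrightarrow> (a, \<^bold>0) \<in> D"
  by (simp add: D_iff)

lemma mv_pl_unit:
  assumes "(a, \<^bold>0) \<in> D" "(b, \<^bold>0) \<in> D" "c = (a \<^bold>+ b) \<^bold>\<and> \<^bold>1"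
  shows "mv_pl (cls (a, \<^bold>0)) (cls (b, \<^bold>0)) = cls (c, \<^bold>0)"
  using assms by (simp add: mv_cls)

text \<open>The product is the positive part of \<open>a + b - 1\<close>, that is
  \<open>1 + a + b\<close> minus the smaller of \<open>1 + 1\<close> and \<open>1 + a + b\<close>.
  The condition on \<open>c\<close> states this without subtraction.\<close>

lemma mv_tm_unit:
  assumes "(a, \<^bold>0) \<in> D" "(b, \<^bold>0) \<in> D" "(c, \<^bold>0) \<in> D"
    and c: "c \<^bold>+ ((\<^bold>1 \<^bold>+ \<^bold>1) \<^bold>\<and> (\<^bold>1 \<^bold>+ (a \<^bold>+ b))) = \<^bold>1 \<^bold>+ (a \<^bold>+ b)"
  shows "mv_tm (cls (a, \<^bold>0)) (cls (b, \<^bold>0)) = cls (c, \<^bold>0)"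
proof -
  have "neg (neg (a, \<^bold>0) \<^bold>\<oplus> neg (b, \<^bold>0)) \<approx> (c, \<^bold>0)"
    using assms(1-3) c by (simp add: D_iff add_assoc add_comm add_left_comm)
  then show ?thesis
    using assms(1-3) by (simp add: mv_tm_def mv_cls cls_eq_iff del: neg.simps plus.simps)
qed

text \<open>The join is specified as \<open>a + b\<close> minus the meet. As \<open>a\<close> and
  \<open>b\<close> are at most 1, \<open>a + b\<close> lies below \<open>m\<close>, so the outer
  truncation in \<open>neg_plus_join\<close> has no effect.\<close>

lemma mv_jn_unit:
  assumes "(a, \<^bold>0) \<in> D" "(b, \<^bold>0) \<in> D" "(c, \<^bold>0) \<in> D" and c: "c \<^bold>+ (a \<^bold>\<and> b) = a \<^bold>+ b"
  shows "mv_jn (cls (a, \<^bold>0)) (cls (b, \<^bold>0)) = cls (c, \<^bold>0)"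
proof -
  define m where "m = (a \<^bold>+ \<^bold>0 \<^bold>+ \<^bold>1) \<^bold>\<and> (b \<^bold>+ \<^bold>0 \<^bold>+ \<^bold>1)"
  have P: "a \<in> P" "b \<in> P" "c \<in> P" "a \<^bold>\<and> \<^bold>1 = a" "b \<^bold>\<and> \<^bold>1 = b"
    using assms by (simp_all add: D_iff)
  have m: "m = \<^bold>1 \<^bold>+ (a \<^bold>\<and> b)"
    using P by (simp add: m_def add_inf add_comm)
  have cm: "c \<^bold>+ m = a \<^bold>+ b \<^bold>+ \<^bold>1"
    using P c by (simp add: m add_left_comm[of c] add_comm[of _ "\<^bold>1"])
  have "(a \<^bold>+ b) \<^bold>\<and> (\<^bold>1 \<^bold>+ a) = a \<^bold>+ b" "(a \<^bold>+ b) \<^bold>\<and> (\<^bold>1 \<^bold>+ b) = a \<^bold>+ b"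
    using P inf_add_mono[of a a b "\<^bold>1"] inf_add_mono[of a "\<^bold>1" b b] by (simp_all add: add_comm)
  then have "(a \<^bold>+ b) \<^bold>\<and> m = a \<^bold>+ b"
    using P by (simp add: m add_inf inf_assoc[symmetric])
  then have "(a \<^bold>+ b \<^bold>+ \<^bold>1) \<^bold>\<and> (m \<^bold>+ \<^bold>1) = a \<^bold>+ b \<^bold>+ \<^bold>1"
    using P m by (simp add: inf_add[symmetric])
  then have "neg (neg (a, \<^bold>0) \<^bold>\<oplus> (b, \<^bold>0)) \<^bold>\<oplus> (b, \<^bold>0) \<approx> (c, \<^bold>0)"
    unfolding neg_plus_join[OF assms(1,2) m_def]
    using P m cm by (simp add: add_assoc add_comm add_left_comm)
  then show ?thesis
    using assms by (simp add: mv_jn_cls cls_eq_iff mv_cls del: neg.simps plus.simps)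
qed

text \<open>The negated join of the complements \<open>(1, a)\<close> and \<open>(1, b)\<close>.
  Here \<open>m\<close> lies above \<open>1 + 1\<close>, and again the outer truncation has no
  effect.\<close>

lemma mv_mt_unit:
  assumes "(a, \<^bold>0) \<in> D" "(b, \<^bold>0) \<in> D" "(a \<^bold>\<and> b, \<^bold>0) \<in> D"
  shows "mv_mt (cls (a, \<^bold>0)) (cls (b, \<^bold>0)) = cls (a \<^bold>\<and> b, \<^bold>0)"
proof -
  define m where "m = (\<^bold>1 \<^bold>+ b \<^bold>+ \<^bold>1) \<^bold>\<and> (\<^bold>1 \<^bold>+ a \<^bold>+ \<^bold>1)"
  have P: "a \<in> P" "b \<in> P" "\<^bold>0 \<^bold>\<and> a = \<^bold>0" "\<^bold>0 \<^bold>\<and> b = \<^bold>0" "\<^bold>0 \<^bold>\<and> (a \<^bold>\<and> b) = \<^bold>0"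
    using assms by (simp_all add: D_iff)
  have m: "m = \<^bold>1 \<^bold>+ \<^bold>1 \<^bold>+ (a \<^bold>\<and> b)"
    using P by (simp add: m_def add_inf inf_comm add_assoc add_comm add_left_comm)
  have "(\<^bold>1 \<^bold>+ \<^bold>1) \<^bold>\<and> m = \<^bold>1 \<^bold>+ \<^bold>1"
    using P inf_add_mono[of "\<^bold>1 \<^bold>+ \<^bold>1" "\<^bold>1 \<^bold>+ \<^bold>1" "\<^bold>0" "a \<^bold>\<and> b"] by (simp add: m)
  then have k: "(\<^bold>1 \<^bold>+ b \<^bold>+ \<^bold>1 \<^bold>+ \<^bold>1) \<^bold>\<and> (m \<^bold>+ b \<^bold>+ \<^bold>1) = \<^bold>1 \<^bold>+ b \<^bold>+ \<^bold>1 \<^bold>+ \<^bold>1"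
    using P m inf_add[of "b \<^bold>+ \<^bold>1" "\<^bold>1 \<^bold>+ \<^bold>1" m] by (simp add: add_assoc add_comm add_left_comm)
  have D: "(\<^bold>1, a) \<in> D" "(\<^bold>1, b) \<in> D"
    using neg_D[OF assms(1)] neg_D[OF assms(2)] by simp_all
  have "neg (neg (neg (\<^bold>1, a) \<^bold>\<oplus> (\<^bold>1, b)) \<^bold>\<oplus> (\<^bold>1, b)) \<approx> (a \<^bold>\<and> b, \<^bold>0)"
    unfolding neg_plus_join[OF D m_def] k
    using P m by (simp add: add_assoc add_comm add_left_comm)
  moreover have "neg (a, \<^bold>0) = (\<^bold>1, a)" "neg (b, \<^bold>0) = (\<^bold>1, b)"
    by simp_all
  ultimately show ?thesis
    using assms D by (simp add: mv_mt_def mv_jn_cls cls_eq_iff mv_cls del: neg.simps plus.simps)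
qed

end

section \<open>Good sequences\<close>

locale mv_monoidal =
  fixes A :: "'a set" and pl (infixl "\<oplus>" 65) and tm (infixl "\<odot>" 70)
    and jn (infixl "\<squnion>" 62) and mt (infixl "\<sqinter>" 64) and z u
  assumes mv_monoidal: "MV_monoidal A pl tm jn mt z u"
begin

lemma closed [simp]:
  "z \<in> A" "u \<in> A"
  "x \<in> A \<Longrightarrow> y \<in> A \<Longrightarrow> x \<oplus> y \<in> A" "x \<in> A \<Longrightarrow> y \<in> A \<Longrightarrow> x \<odot> y \<in> A"
  "x \<in> A \<Longrightarrow> y \<in> A \<Longrightarrow> x \<squnion> y \<in> A" "x \<in> A \<Longrightarrow> y \<in> A \<Longrightarrow> x \<sqinter> y \<in> A"
  using mv_monoidal unfolding MV_monoidal_def closed_alg_def by auto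

lemma jn_assoc: "x \<in> A \<Longrightarrow> y \<in> A \<Longrightarrow> w \<in> A \<Longrightarrow> x \<squnion> y \<squnion> w = x \<squnion> (y \<squnion> w)"
  and mt_assoc: "x \<in> A \<Longrightarrow> y \<in> A \<Longrightarrow> w \<in> A \<Longrightarrow> x \<sqinter> y \<sqinter> w = x \<sqinter> (y \<sqinter> w)"
  and jn_comm: "x \<in> A \<Longrightarrow> y \<in> A \<Longrightarrow> x \<squnion> y = y \<squnion> x"
  and mt_comm: "x \<in> A \<Longrightarrow> y \<in> A \<Longrightarrow> x \<sqinter> y = y \<sqinter> x"
  and jn_absorb [simp]: "x \<in> A \<Longrightarrow> y \<in> A \<Longrightarrow> x \<squnion> (x \<sqinter> y) = x"
  and mt_absorb [simp]: "x \<in> A \<Longrightarrow> y \<in> A \<Longrightarrow> x \<sqinter> (x \<squnion> y) = x"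
  and pl_assoc: "x \<in> A \<Longrightarrow> y \<in> A \<Longrightarrow> w \<in> A \<Longrightarrow> x \<oplus> y \<oplus> w = x \<oplus> (y \<oplus> w)"
  and tm_assoc: "x \<in> A \<Longrightarrow> y \<in> A \<Longrightarrow> w \<in> A \<Longrightarrow> x \<odot> y \<odot> w = x \<odot> (y \<odot> w)"
  and pl_comm: "x \<in> A \<Longrightarrow> y \<in> A \<Longrightarrow> x \<oplus> y = y \<oplus> x"
  and tm_comm: "x \<in> A \<Longrightarrow> y \<in> A \<Longrightarrow> x \<odot> y = y \<odot> x"
  and pl_z [simp]: "x \<in> A \<Longrightarrow> x \<oplus> z = x"
  and tm_u [simp]: "x \<in> A \<Longrightarrow> x \<odot> u = x"
  and pl_jn: "x \<in> A \<Longrightarrow> y \<in> A \<Longrightarrow> w \<in> A \<Longrightarrow> x \<oplus> (y \<squnion> w) = (x \<oplus> y) \<squnion> (x \<oplus> w)"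
  and pl_mt: "x \<in> A \<Longrightarrow> y \<in> A \<Longrightarrow> w \<in> A \<Longrightarrow> x \<oplus> (y \<sqinter> w) = (x \<oplus> y) \<sqinter> (x \<oplus> w)"
  and tm_jn: "x \<in> A \<Longrightarrow> y \<in> A \<Longrightarrow> w \<in> A \<Longrightarrow> x \<odot> (y \<squnion> w) = x \<odot> y \<squnion> x \<odot> w"
  and tm_mt: "x \<in> A \<Longrightarrow> y \<in> A \<Longrightarrow> w \<in> A \<Longrightarrow> x \<odot> (y \<sqinter> w) = x \<odot> y \<sqinter> x \<odot> w"
  using mv_monoidal unfolding MV_monoidal_def by meson+

lemma E4: "x \<in> A \<Longrightarrow> y \<in> A \<Longrightarrow> w \<in> A \<Longrightarrow>
      (x \<oplus> y) \<odot> (x \<odot> y \<oplus> w) = x \<odot> (y \<oplus> w) \<oplus> y \<odot> w"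
  and E5: "x \<in> A \<Longrightarrow> y \<in> A \<Longrightarrow> w \<in> A \<Longrightarrow>
      x \<odot> y \<oplus> (x \<oplus> y) \<odot> w = (x \<oplus> y \<odot> w) \<odot> (y \<oplus> w)"
  and E6: "x \<in> A \<Longrightarrow> y \<in> A \<Longrightarrow> w \<in> A \<Longrightarrow>
      x \<odot> y \<oplus> w = (x \<oplus> y) \<odot> (x \<odot> y \<oplus> w) \<squnion> w"
  and E7: "x \<in> A \<Longrightarrow> y \<in> A \<Longrightarrow> w \<in> A \<Longrightarrow>
      (x \<oplus> y) \<odot> w = (x \<odot> y \<oplus> (x \<oplus> y) \<odot> w) \<sqinter> w"
  using mv_monoidal unfolding MV_monoidal_def by blast+

lemma pl_left_comm: "x \<in> A \<Longrightarrow> y \<in> A \<Longrightarrow> w \<in> A \<Longrightarrow> x \<oplus> (y \<oplus> w) = y \<oplus> (x \<oplus> w)"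
  using pl_assoc[of x y w] pl_assoc[of y x w] pl_comm[of x y] by simp

lemma tm_left_comm: "x \<in> A \<Longrightarrow> y \<in> A \<Longrightarrow> w \<in> A \<Longrightarrow> x \<odot> (y \<odot> w) = y \<odot> (x \<odot> w)"
  using tm_assoc[of x y w] tm_assoc[of y x w] tm_comm[of x y] by simp

section \<open>The order of an MV-monoidal algebra\<close>

definition le (infix "\<preceq>" 50) where "x \<preceq> y \<longleftrightarrow> x \<sqinter> y = x"

lemma mt_idem [simp]: "x \<in> A \<Longrightarrow> x \<sqinter> x = x"
  using mt_absorb[of x "x \<sqinter> x"] by simp

lemma le_iff_jn: "x \<in> A \<Longrightarrow> y \<in> A \<Longrightarrow> x \<preceq> y \<longleftrightarrow> x \<squnion> y = y"
  unfolding le_def using mt_absorb[of x y] jn_absorb[of y x] jn_comm[of x y] mt_comm[of x y] by metis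

lemma le_refl [simp]: "x \<in> A \<Longrightarrow> x \<preceq> x"
  by (simp add: le_def)

lemma le_antisym: "x \<preceq> y \<Longrightarrow> y \<preceq> x \<Longrightarrow> x \<in> A \<Longrightarrow> y \<in> A \<Longrightarrow> x = y"
  using mt_comm[of x y] by (simp add: le_def)

lemma le_trans: "x \<preceq> y \<Longrightarrow> y \<preceq> w \<Longrightarrow> x \<in> A \<Longrightarrow> y \<in> A \<Longrightarrow> w \<in> A \<Longrightarrow> x \<preceq> w"
  using mt_assoc[of x y w] by (simp add: le_def)

lemma mt_le [simp]: "x \<in> A \<Longrightarrow> y \<in> A \<Longrightarrow> x \<sqinter> y \<preceq> x" "x \<in> A \<Longrightarrow> y \<in> A \<Longrightarrow> x \<sqinter> y \<preceq> y"
proof -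
  show "x \<sqinter> y \<preceq> y" if "x \<in> A" "y \<in> A" for x y
    using that by (simp add: le_def mt_assoc)
  then show "x \<in> A \<Longrightarrow> y \<in> A \<Longrightarrow> x \<sqinter> y \<preceq> x"
    using mt_comm[of x y] by simp
qed

lemma jn_ge [simp]: "x \<in> A \<Longrightarrow> y \<in> A \<Longrightarrow> x \<preceq> x \<squnion> y" "x \<in> A \<Longrightarrow> y \<in> A \<Longrightarrow> y \<preceq> x \<squnion> y"
  using mt_absorb[of y x] by (simp_all add: le_def jn_comm)

lemma le_mt_iff:
  assumes "x \<in> A" "y \<in> A" "w \<in> A"
  shows "w \<preceq> x \<sqinter> y \<longleftrightarrow> w \<preceq> x \<and> w \<preceq> y"
proof
  show "w \<preceq> x \<and> w \<preceq> y" if "w \<preceq> x \<sqinter> y"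
    using le_trans[OF that mt_le(1)] le_trans[OF that mt_le(2)] assms by simp
  show "w \<preceq> x \<sqinter> y" if "w \<preceq> x \<and> w \<preceq> y"
    using that mt_assoc[of w x y] assms by (simp add: le_def)
qed

lemma jn_least: "x \<preceq> w \<Longrightarrow> y \<preceq> w \<Longrightarrow> x \<in> A \<Longrightarrow> y \<in> A \<Longrightarrow> w \<in> A \<Longrightarrow> x \<squnion> y \<preceq> w"
  by (simp add: le_iff_jn jn_assoc)

lemma pl_mono:
  assumes "x \<preceq> y" "x \<in> A" "y \<in> A" "w \<in> A"
  shows "w \<oplus> x \<preceq> w \<oplus> y"
  using assms pl_mt[of w x y] by (simp add: le_def)

lemma tm_mono:
  assumes "x \<preceq> y" "x \<in> A" "y \<in> A" "w \<in> A"
  shows "w \<odot> x \<preceq> w \<odot> y"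
  using assms tm_mt[of w x y] by (simp add: le_def)

lemma pl_mono2:
  assumes "x \<preceq> y" "x' \<preceq> y'" and A: "x \<in> A" "y \<in> A" "x' \<in> A" "y' \<in> A"
  shows "x \<oplus> x' \<preceq> y \<oplus> y'"
  using le_trans[OF pl_mono[OF assms(2), of x] pl_mono[OF assms(1), of y', simplified pl_comm[of y']]] A
  by simp

text \<open>(E7) with \<open>z\<close> in place of \<open>y\<close> displays the product as a meet
  with \<open>w\<close>. Dually, (E6) with \<open>u\<close> gives \<open>le_pl\<close>; the bounds
  and the absorbing laws for \<open>z\<close> and \<open>u\<close> follow.\<close>

lemma tm_le [simp]:
  assumes "x \<in> A" "w \<in> A"
  shows "x \<odot> w \<preceq> w" "w \<odot> x \<preceq> w"
proof -
  have "x \<odot> w = (x \<odot> z \<oplus> x \<odot> w) \<sqinter> w"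
    using E7[of x z w] assms by simp
  then show "x \<odot> w \<preceq> w"
    using assms mt_le(2)[of "x \<odot> z \<oplus> x \<odot> w" w] by simp
  then show "w \<odot> x \<preceq> w"
    using assms by (simp add: tm_comm)
qed

lemma le_pl [simp]:
  assumes "x \<in> A" "w \<in> A"
  shows "w \<preceq> x \<oplus> w" "w \<preceq> w \<oplus> x"
proof -
  have "x \<oplus> w = (x \<oplus> u) \<odot> (x \<oplus> w) \<squnion> w"
    using E6[of x u w] assms by simp
  then show "w \<preceq> x \<oplus> w"
    using assms jn_ge(2)[of "(x \<oplus> u) \<odot> (x \<oplus> w)" w] by simp
  then show "w \<preceq> w \<oplus> x"
    using assms by (simp add: pl_comm)
qed

lemma z_le [simp]: "x \<in> A \<Longrightarrow> z \<preceq> x" and le_u [simp]: "x \<in> A \<Longrightarrow> x \<preceq> u"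
  using le_pl(2)[of x z] tm_le(1)[of x u] by (simp_all add: pl_comm[of z])

lemma z_pl [simp]: "x \<in> A \<Longrightarrow> z \<oplus> x = x" and u_tm [simp]: "x \<in> A \<Longrightarrow> u \<odot> x = x"
  by (simp_all add: pl_comm[of z] tm_comm[of u])

lemma tm_z [simp]: "x \<in> A \<Longrightarrow> x \<odot> z = z" "x \<in> A \<Longrightarrow> z \<odot> x = z"
  using tm_le[of x z] by (auto intro: le_antisym)

lemma pl_u [simp]: "x \<in> A \<Longrightarrow> x \<oplus> u = u" "x \<in> A \<Longrightarrow> u \<oplus> x = u"
  using le_pl[of x u] by (auto intro: le_antisym)

text \<open>In a unit interval, \<open>(x, y)\<close> is good iff it is the pair of truncations of \<open>x + y\<close>
  and \<open>x + y - 1\<close> to the interval.\<close>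

definition good where "good x y \<longleftrightarrow> x \<in> A \<and> y \<in> A \<and> x \<oplus> y = x \<and> x \<odot> y = y"

lemma goodD: "good x y \<Longrightarrow> x \<in> A" "good x y \<Longrightarrow> y \<in> A" "good x y \<Longrightarrow> x \<oplus> y = x" "good x y \<Longrightarrow> x \<odot> y = y"
  by (simp_all add: good_def)

text \<open>(E5), in which \<open>x\<close> absorbs \<open>y \<odot> a\<close>. An entry obtained by
  adding \<open>a\<close> to a good sequence can therefore be read as a sum or as a product.\<close>

lemma good_exchange:
  assumes "good x y" "a \<in> A"
  shows "y \<oplus> a \<odot> x = x \<odot> (y \<oplus> a)"
proof -
  note g = goodD[OF assms(1)]
  have "x \<oplus> y \<odot> a = x"
    using g assms pl_mono[of "y \<odot> a" y x] by (intro le_antisym) simp_all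
  then show ?thesis
    using E5[of x y a] g assms(2) by (simp add: tm_comm)
qed

lemma good_E7:
  assumes "good x y" "a \<in> A"
  shows "x \<odot> a = (y \<oplus> x \<odot> a) \<sqinter> a"
  using E7[of x y a] goodD[OF assms(1)] assms(2) by simp

lemma good_E6:
  assumes "good x y" "a \<in> A"
  shows "y \<oplus> a = x \<odot> (y \<oplus> a) \<squnion> a"
  using E6[of x y a] goodD[OF assms(1)] assms(2) by simp

text \<open>For three consecutive entries \<open>r\<close>, \<open>s\<close>, \<open>t\<close>: the
  sum condition is (E4) at \<open>r\<close>, \<open>s\<close>, \<open>a\<close>, the product
  condition is (E5) at \<open>t\<close>, \<open>s\<close>, \<open>a\<close> multiplied by
  \<open>r\<close>, with \<open>r \<odot> s = s\<close>.\<close>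

lemma good_sum:
  assumes "good r s" "good s t" "a \<in> A"
  shows "good (s \<oplus> a \<odot> r) (t \<oplus> a \<odot> s)"
proof -
  note A = goodD[OF assms(1)] goodD[OF assms(2)] \<open>a \<in> A\<close>
  have *: "s \<oplus> p \<oplus> (t \<oplus> q) = (s \<oplus> t) \<oplus> p \<oplus> q" if "s \<in> A" "t \<in> A" "p \<in> A" "q \<in> A" for s t p q
    using that by (simp add: pl_assoc pl_left_comm)
  have "s \<oplus> a \<odot> r \<oplus> (t \<oplus> a \<odot> s) = (s \<oplus> t) \<oplus> a \<odot> r \<oplus> a \<odot> s"
    by (rule *) (use A in simp_all)
  also have "\<dots> = r \<odot> (s \<oplus> a) \<oplus> s \<odot> a"
    using A good_exchange[OF assms(1,3)] by (simp add: tm_comm)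
  also have "\<dots> = s \<oplus> a \<odot> r"
    using E4[of r s a] good_exchange[OF assms(1,3)] A by simp
  finally have 1: "s \<oplus> a \<odot> r \<oplus> (t \<oplus> a \<odot> s) = s \<oplus> a \<odot> r" .
  have "(s \<oplus> a) \<odot> (t \<oplus> a \<odot> s) = t \<oplus> a \<odot> s"
    using E5[of t s a] A by (simp add: tm_comm pl_comm[of _ s] tm_comm[of t s] pl_comm[of t])
  then have "r \<odot> ((s \<oplus> a) \<odot> (t \<oplus> a \<odot> s)) = r \<odot> (s \<odot> (t \<oplus> a))"
    using good_exchange[OF assms(2,3)] by simp
  also have "\<dots> = t \<oplus> a \<odot> s"
    using A good_exchange[OF assms(2,3)] by (simp add: tm_assoc[symmetric])
  finally have 2: "(s \<oplus> a \<odot> r) \<odot> (t \<oplus> a \<odot> s) = t \<oplus> a \<odot> s"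
    using A good_exchange[OF assms(1,3)] by (simp add: tm_assoc)
  show ?thesis
    using 1 2 A by (simp add: good_def)
qed

text \<open>The right-hand side of (E4) is symmetric in \<open>y\<close> and \<open>w\<close>, the left-hand side in \<open>x\<close> and \<open>y\<close>.\<close>

lemma E4_symmetric:
  assumes "x \<in> A" "y \<in> A" "w \<in> A"
  shows "x \<odot> (y \<oplus> w) \<oplus> y \<odot> w = w \<odot> (y \<oplus> x) \<oplus> x \<odot> y"
  using assms E4[of x y w] E4[of y x w] E4[of x w y] E4[of w x y] E4[of y w x] E4[of w y x]
  by (simp add: pl_comm tm_comm)

text \<open>The left side is the entry after adding \<open>b\<close> and then \<open>a\<close>. By
  \<open>good_exchange\<close> its nested part becomes a product with \<open>a \<odot> r\<close>, to
  which \<open>E4_symmetric\<close> applies; \<open>r \<odot> s = s\<close> removes the surplus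
  factor.\<close>

lemma add_add_comm:
  assumes "good r s" "a \<in> A" "b \<in> A" "t \<in> A"
  shows "t \<oplus> b \<odot> s \<oplus> a \<odot> (s \<oplus> b \<odot> r) = t \<oplus> a \<odot> s \<oplus> b \<odot> (s \<oplus> a \<odot> r)"
proof -
  note A = goodD[OF assms(1)] assms(2-)
  have "b \<odot> s \<oplus> a \<odot> (s \<oplus> b \<odot> r) = (a \<odot> r) \<odot> (s \<oplus> b) \<oplus> s \<odot> b"
    using A good_exchange[OF assms(1,3)] by (simp add: tm_assoc tm_comm tm_left_comm pl_comm)
  also have "\<dots> = b \<odot> (s \<oplus> a \<odot> r) \<oplus> a \<odot> r \<odot> s"
    using A by (intro E4_symmetric) simp_all
  also have "\<dots> = a \<odot> s \<oplus> b \<odot> (s \<oplus> a \<odot> r)"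
    using A by (simp add: tm_assoc pl_comm)
  finally show ?thesis
    using A by (simp add: pl_assoc)
qed

text \<open>The difficulty is the mixed products such as \<open>s \<odot> t'\<close>. By
  \<open>good_E7\<close> this one is the meet of \<open>t'\<close> with an element above
  \<open>s'\<close>.\<close>

lemma good_mt:
  assumes "good s s'" "good t t'"
  shows "good (s \<sqinter> t) (s' \<sqinter> t')"
proof -
  have tm: "s' \<sqinter> t' \<preceq> s \<odot> t'" if "good s s'" "good t t'" for s s' t t'
  proof -
    note A = goodD[OF that(1)] goodD[OF that(2)]
    have "s' \<sqinter> t' \<preceq> s' \<oplus> s \<odot> t'"
      by (rule le_trans[of _ s']) (use A in simp_all)
    then have "s' \<sqinter> t' \<preceq> (s' \<oplus> s \<odot> t') \<sqinter> t'"
      using A by (simp add: le_mt_iff)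
    then show ?thesis
      using good_E7[OF that(1), of t'] A by simp
  qed
  note A = goodD[OF assms(1)] goodD[OF assms(2)]
  have M: "s \<sqinter> t \<in> A" "s' \<sqinter> t' \<in> A"
    using A by simp_all
  have "s' \<sqinter> t' \<preceq> (s \<sqinter> t) \<odot> (s' \<sqinter> t')"
    using A tm[OF assms] tm[OF assms(2,1)]
    by (simp add: tm_mt tm_comm[of "s \<sqinter> t"] tm_comm[of _ s] tm_comm[of _ t] mt_comm[of t' s'] le_mt_iff)
  then have 1: "(s \<sqinter> t) \<odot> (s' \<sqinter> t') = s' \<sqinter> t'"
    using A by (intro le_antisym) simp_all
  have "(s \<sqinter> t) \<oplus> (s' \<sqinter> t') \<preceq> s \<oplus> s'" "(s \<sqinter> t) \<oplus> (s' \<sqinter> t') \<preceq> t \<oplus> t'"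
    by (rule pl_mono2; use A in simp)+
  then have "(s \<sqinter> t) \<oplus> (s' \<sqinter> t') \<preceq> s \<sqinter> t"
    using A M by (simp add: le_mt_iff)
  then have "(s \<sqinter> t) \<oplus> (s' \<sqinter> t') = s \<sqinter> t"
    using M by (intro le_antisym) simp_all
  then show ?thesis
    using 1 M by (simp add: good_def)
qed

text \<open>Read as a product by \<open>good_exchange\<close>, the left side is a meet of four
  products. Two of them make up \<open>?X\<close>; \<open>cross\<close> shows by
  \<open>good_E7\<close> that the mixed ones are above \<open>?X\<close>.\<close>

lemma good_sum_mt:
  assumes "good s s'" "good t t'" "a \<in> A"
  shows "(s' \<sqinter> t') \<oplus> a \<odot> (s \<sqinter> t) = (s' \<oplus> a \<odot> s) \<sqinter> (t' \<oplus> a \<odot> t)"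
proof (rule le_antisym)
  note A = goodD[OF assms(1)] goodD[OF assms(2)] assms(3)
  let ?X = "(s' \<oplus> a \<odot> s) \<sqinter> (t' \<oplus> a \<odot> t)"
  have cross: "s \<odot> (s' \<oplus> a) \<sqinter> t \<odot> (t' \<oplus> a) \<preceq> t \<odot> (s' \<oplus> a)"
    if g: "good s s'" "good t t'" for s s' t t'
  proof -
    note A = goodD[OF g(1)] goodD[OF g(2)] assms(3)
    let ?Y = "s \<odot> (s' \<oplus> a) \<sqinter> t \<odot> (t' \<oplus> a)"
    have "?Y \<preceq> s' \<oplus> a"
      by (rule le_trans[of _ "s \<odot> (s' \<oplus> a)"]) (use A in simp_all)
    moreover have "?Y \<preceq> t' \<oplus> t \<odot> (s' \<oplus> a)"
    proof (rule le_trans)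
      show "?Y \<preceq> t \<odot> (t' \<oplus> a)"
        using A by simp
      have "t \<odot> (t' \<oplus> a) \<preceq> t \<odot> (t' \<oplus> (s' \<oplus> a))"
        using A by (intro tm_mono pl_mono) simp_all
      then show "t \<odot> (t' \<oplus> a) \<preceq> t' \<oplus> t \<odot> (s' \<oplus> a)"
        using good_exchange[OF g(2), of "s' \<oplus> a"] A by (simp add: tm_comm)
    qed (use A in simp_all)
    ultimately show ?thesis
      using A by (subst good_E7[OF g(2)]) (simp_all add: le_mt_iff)
  qed
  have X: "?X = s \<odot> (s' \<oplus> a) \<sqinter> t \<odot> (t' \<oplus> a)"
    using good_exchange[OF assms(1,3)] good_exchange[OF assms(2,3)] by simp
  have 1: "?X \<preceq> t \<odot> (s' \<oplus> a)" "?X \<preceq> s \<odot> (t' \<oplus> a)"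
    using cross[OF assms(1,2)] cross[OF assms(2,1)] A
    unfolding X by (simp_all add: mt_comm)
  have 2: "?X \<preceq> s \<odot> (s' \<oplus> a)" "?X \<preceq> t \<odot> (t' \<oplus> a)"
    using A unfolding X by simp_all
  have "(s' \<sqinter> t') \<oplus> a \<odot> (s \<sqinter> t) = (s \<sqinter> t) \<odot> ((s' \<sqinter> t') \<oplus> a)"
    by (rule good_exchange[OF good_mt[OF assms(1,2)] assms(3)])
  also have "(s' \<sqinter> t') \<oplus> a = (s' \<oplus> a) \<sqinter> (t' \<oplus> a)"
    using pl_mt[of a s' t'] A by (simp add: pl_comm)
  also have "(s \<sqinter> t) \<odot> ((s' \<oplus> a) \<sqinter> (t' \<oplus> a)) = (s \<sqinter> t) \<odot> (s' \<oplus> a) \<sqinter> (s \<sqinter> t) \<odot> (t' \<oplus> a)"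
    using A by (intro tm_mt) simp_all
  also have "(s \<sqinter> t) \<odot> (s' \<oplus> a) = s \<odot> (s' \<oplus> a) \<sqinter> t \<odot> (s' \<oplus> a)"
    using tm_mt[of "s' \<oplus> a" s t] A by (simp add: tm_comm[of _ "s' \<oplus> a"])
  also have "(s \<sqinter> t) \<odot> (t' \<oplus> a) = s \<odot> (t' \<oplus> a) \<sqinter> t \<odot> (t' \<oplus> a)"
    using tm_mt[of "t' \<oplus> a" s t] A by (simp add: tm_comm[of _ "t' \<oplus> a"])
  finally show "?X \<preceq> (s' \<sqinter> t') \<oplus> a \<odot> (s \<sqinter> t)"
    using A 1 2 by (simp add: le_mt_iff)
  have "(s' \<sqinter> t') \<oplus> a \<odot> (s \<sqinter> t) \<preceq> s' \<oplus> a \<odot> s" "(s' \<sqinter> t') \<oplus> a \<odot> (s \<sqinter> t) \<preceq> t' \<oplus> a \<odot> t"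
    using A by (auto intro!: pl_mono2 tm_mono)
  then show "(s' \<sqinter> t') \<oplus> a \<odot> (s \<sqinter> t) \<preceq> ?X"
    using A by (simp add: le_mt_iff)
qed (use goodD[OF assms(1)] goodD[OF assms(2)] assms(3) in simp_all)

lemma good_u [simp]: "x \<in> A \<Longrightarrow> good u x"
  by (simp add: good_def)

text \<open>The sequence \<open>s\<close> lists the truncations of \<open>x, x - 1, x - 2, \<dots>\<close> to the unit interval,
  for some \<open>x\<close> in the positive cone of the enveloping group; the index starts at \<open>1\<close>,
  with \<open>u\<close> at \<open>0\<close>.\<close>

definition seqs where
  "seqs = {s. s 0 = u \<and> (\<forall>k. good (s k) (s (Suc k))) \<and> (\<exists>n. \<forall>k>n. s k = z)}"

text \<open>The value \<open>u\<close> at index 0 keeps the formula uniform: the entry at 1 becomes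
  \<open>s 1 \<oplus> a\<close>.\<close>

definition ins where "ins a s k = (case k of 0 \<Rightarrow> u | Suc i \<Rightarrow> s (Suc i) \<oplus> a \<odot> s i)"

definition origin :: "nat \<Rightarrow> 'a" where "origin k = (if k = 0 then u else z)"

definition build where "build L = foldr ins L origin"

definition pmt where "pmt s t = (\<lambda>k :: nat. s k \<sqinter> t k)"

lemma ins_simps [simp]: "ins a s 0 = u" "ins a s (Suc i) = s (Suc i) \<oplus> a \<odot> s i"
  by (simp_all add: ins_def)

lemma seqsD:
  assumes "s \<in> seqs"
  shows "s 0 = u" "good (s k) (s (Suc k))" "s k \<in> A"
  using assms by (auto simp: seqs_def good_def)

lemma origin_seqs [simp]: "origin \<in> seqs"
  by (auto simp: seqs_def origin_def good_def)

lemma ins_seqs [simp]: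
  assumes "a \<in> A" "s \<in> seqs"
  shows "ins a s \<in> seqs"
proof -
  have "good (ins a s k) (ins a s (Suc k))" for k
    using assms seqsD[OF assms(2)] by (cases k) (auto intro: good_sum)
  moreover obtain n where "\<forall>k>n. s k = z"
    using assms by (auto simp: seqs_def)
  then have "\<forall>k>Suc n. ins a s k = z"
    using assms by (auto simp: ins_def split: nat.split)
  ultimately show ?thesis
    by (auto simp: seqs_def simp del: ins_simps(2))
qed

lemma ins_comm:
  assumes "a \<in> A" "b \<in> A" "s \<in> seqs"
  shows "ins a (ins b s) = ins b (ins a s)"
proof
  fix k
  consider "k = 0" | "k = Suc 0" | i where "k = Suc (Suc i)"
    by (metis nat.exhaust)
  then show "ins a (ins b s) k = ins b (ins a s) k"
  proof cases
    case 2
    then show ?thesis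
      using assms seqsD[OF assms(3)] by (simp add: pl_assoc pl_comm pl_left_comm)
  next
    case (3 i)
    then show ?thesis
      using assms seqsD[OF assms(3)] add_add_comm[of "s i" "s (Suc i)" a b "s (Suc (Suc i))"] by simp
  qed simp
qed

lemma pmt_seqs [simp]:
  assumes "s \<in> seqs" "t \<in> seqs"
  shows "pmt s t \<in> seqs"
proof -
  obtain n m where "\<forall>k>n. s k = z" "\<forall>k>m. t k = z"
    using assms by (auto simp: seqs_def)
  then have "\<forall>k>max n m. pmt s t k = z"
    by (simp add: pmt_def)
  moreover have "pmt s t 0 = u" "good (pmt s t k) (pmt s t (Suc k))" for k
    using seqsD[OF assms(1)] seqsD[OF assms(2)] by (simp_all add: pmt_def good_mt)
  ultimately show ?thesis
    unfolding seqs_def by blast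
qed

lemma ins_pmt: "a \<in> A \<Longrightarrow> s \<in> seqs \<Longrightarrow> t \<in> seqs \<Longrightarrow> ins a (pmt s t) = pmt (ins a s) (ins a t)"
  by (rule ext) (auto simp: ins_def pmt_def seqsD good_sum_mt split: nat.split)

text \<open>Goodness relates neighbours only. Writing a later entry as a product with its
  predecessor carries the absorption by the first entry along the sequence.\<close>

lemma good_absorb:
  assumes "s \<in> seqs"
  shows "s (Suc 0) \<odot> s (Suc (Suc i)) = s (Suc (Suc i))"
proof (induction i)
  case 0
  show ?case
    using goodD(4)[OF seqsD(2)[OF assms]] .
next
  case (Suc i)
  have *: "s (Suc (Suc i)) \<odot> s (Suc (Suc (Suc i))) = s (Suc (Suc (Suc i)))"
    using goodD(4)[OF seqsD(2)[OF assms]] .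
  have "s (Suc 0) \<odot> (s (Suc (Suc i)) \<odot> s (Suc (Suc (Suc i)))) = s (Suc (Suc i)) \<odot> s (Suc (Suc (Suc i)))"
    using Suc seqsD(3)[OF assms] by (simp add: tm_assoc[symmetric])
  then show ?case
    by (simp only: *)
qed

text \<open>A good sequence is the sum of its own entries. Adding the first entry to the remaining
  sequence gives back \<open>s\<close>, since the first entry absorbs the later ones under products
  and each entry absorbs its successor under sums.\<close>

lemma seqs_build:
  assumes "s \<in> seqs"
  shows "\<exists>L\<in>lists A. s = build L"
proof -
  have *: "\<exists>L\<in>lists A. s = build L" if "s \<in> seqs" "\<forall>k>n. s k = z" for s n
    using that
  proof (induction n arbitrary: s)
    case 0
    then have "s k = origin k" for k
      by (cases k) (simp_all add: origin_def seqsD(1))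
    then have "s = build []"
      by (simp add: build_def fun_eq_iff)
    then show ?case
      by (intro bexI[of _ "[]"]) simp_all
  next
    case (Suc n)
    note A = seqsD[OF Suc.prems(1)]
    \<comment> \<open>The sequence without its first entry, with the conventional \<open>u\<close>
      put back at index 0.\<close>
    define t where "t k = (if k = 0 then u else s (Suc k))" for k
    have t0: "\<forall>k>n. t k = z"
      using Suc.prems(2) by (simp add: t_def)
    moreover have "t 0 = u" "good (t k) (t (Suc k))" for k
      using A by (simp_all add: t_def)
    ultimately have "t \<in> seqs"
      unfolding seqs_def by blast
    with t0 obtain L where L: "L \<in> lists A" "t = build L"
      using Suc.IH[of t] by blast
    have "s k = ins (s (Suc 0)) t k" for k
    proof -
      have *: "s (Suc k) \<oplus> s k = s k" for k
        using goodD[OF A(2), of k] by (simp add: pl_comm)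
      consider "k = 0" | "k = Suc 0" | i where "k = Suc (Suc i)"
        by (metis nat.exhaust)
      then show ?thesis
        by cases (simp_all add: t_def A(1,3) * good_absorb[OF Suc.prems(1)])
    qed
    then have "s = ins (s (Suc 0)) t"
      by (rule ext)
    also have "\<dots> = build (s (Suc 0) # L)"
      unfolding L(2) by (simp add: build_def)
    finally show ?case
      using L(1) A(3) by (intro bexI[of _ "s (Suc 0) # L"]) simp_all
  qed
  obtain n where "\<forall>k>n. s k = z"
    using assms unfolding seqs_def by blast
  then show ?thesis
    by (rule *[OF assms])
qed

section \<open>Addition of good sequences\<close>

lemma foldr_ins_seqs [simp]: "L \<in> lists A \<Longrightarrow> s \<in> seqs \<Longrightarrow> foldr ins L s \<in> seqs"
  by (induction L) auto

lemma build_seqs [simp]: "L \<in> lists A \<Longrightarrow> build L \<in> seqs"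
  by (simp add: build_def)

lemma foldr_ins_ins:
  "L \<in> lists A \<Longrightarrow> a \<in> A \<Longrightarrow> s \<in> seqs \<Longrightarrow> foldr ins L (ins a s) = ins a (foldr ins L s)"
  by (induction L) (auto simp: ins_comm)

lemma foldr_ins_build:
  "L \<in> lists A \<Longrightarrow> K \<in> lists A \<Longrightarrow> foldr ins L (build K) = foldr ins K (build L)"
  by (induction L) (auto simp: build_def foldr_ins_ins)

lemma foldr_ins_pmt:
  "L \<in> lists A \<Longrightarrow> s \<in> seqs \<Longrightarrow> t \<in> seqs \<Longrightarrow> foldr ins L (pmt s t) = pmt (foldr ins L s) (foldr ins L t)"
  by (induction L) (auto simp: ins_pmt)

definition decomp where "decomp s = (SOME L. L \<in> lists A \<and> build L = s)"

lemma decomp: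
  assumes "s \<in> seqs"
  shows "decomp s \<in> lists A" "build (decomp s) = s"
proof -
  have "\<exists>L. L \<in> lists A \<and> build L = s"
    using seqs_build[OF assms] by blast
  then have "decomp s \<in> lists A \<and> build (decomp s) = s"
    unfolding decomp_def by (rule someI_ex)
  then show "decomp s \<in> lists A" "build (decomp s) = s"
    by simp_all
qed

definition psum where "psum s t = foldr ins (decomp s) t"

text \<open>The choice made by \<open>decomp\<close> is immaterial: with \<open>t = build K\<close>,
  \<open>foldr_ins_build\<close> exchanges the two lists, after which \<open>L\<close> enters only
  through \<open>build L\<close>.\<close>

lemma psum_build:
  assumes "L \<in> lists A" "t \<in> seqs"
  shows "psum (build L) t = foldr ins L t"
proof -
  obtain K where K: "K \<in> lists A" "t = build K"
    using seqs_build assms(2) by blast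
  have "psum (build L) t = foldr ins K (build (decomp (build L)))"
    unfolding psum_def K(2) using assms(1) K(1) decomp(1) by (intro foldr_ins_build) simp_all
  also have "\<dots> = foldr ins L t"
    unfolding K(2) using assms(1) K(1) decomp(2) foldr_ins_build[of K L] by simp
  finally show ?thesis .
qed

end

locale cancellative_mv_monoidal = mv_monoidal +
  assumes cancellative: "cancellative A pl tm"
begin

text \<open>The entry \<open>?x\<close> occurs in two entries of the new sequence. The one at its
  own index determines \<open>?x \<oplus> a\<close> by \<open>good_E6\<close>, the next one
  \<open>?x \<odot> a\<close> by \<open>good_E7\<close>; the quasi-identity then determines
  \<open>?x\<close>.\<close>

lemma ins_inj:
  assumes "a \<in> A" "s \<in> seqs" "t \<in> seqs" and eq: "ins a s = ins a t"
  shows "s = t"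
proof
  show "s k = t k" for k
  proof (induction k)
    case 0
    then show ?case
      using assms by (simp add: seqsD)
  next
    case (Suc k)
    note S = seqsD[OF assms(2)] and T = seqsD[OF assms(3)]
    let ?x = "s (Suc k)" and ?y = "t (Suc k)"
    have eq: "s (Suc i) \<oplus> a \<odot> s i = t (Suc i) \<oplus> a \<odot> t i" for i
      using fun_cong[OF eq, of "Suc i"] by simp
    have "?x \<odot> a = ?y \<odot> a"
      using good_E7[OF S(2) assms(1), of "Suc k"] good_E7[OF T(2) assms(1), of "Suc k"] eq[of "Suc k"]
        S(3) T(3) assms(1) by (simp add: tm_comm)
    moreover have "?x \<oplus> a = ?y \<oplus> a"
      using good_E6[OF S(2) assms(1), of k] good_E6[OF T(2) assms(1), of k] eq[of k]
        good_exchange[OF S(2) assms(1), of k] good_exchange[OF T(2) assms(1), of k] Suc by simp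
    ultimately show ?case
      using cancellative S(3) T(3) assms(1) unfolding cancellative_def by blast
  qed
qed

lemma foldr_ins_inj:
  "L \<in> lists A \<Longrightarrow> s \<in> seqs \<Longrightarrow> t \<in> seqs \<Longrightarrow> foldr ins L s = foldr ins L t \<Longrightarrow> s = t"
proof (induction L)
  case (Cons a L)
  then have "foldr ins L s = foldr ins L t"
    by (rule_tac ins_inj[of a]) simp_all
  with Cons show ?case
    by simp
qed simp

lemma unital_cancel_monoid_seqs:
  fixes f :: "'a list \<times> 'a list \<Rightarrow> 'c"
  assumes "inj f"
  shows "unital_cancel_monoid seqs psum pmt origin (build [u]) (\<lambda>(s, t). f (decomp s, decomp t))"
proof
  fix p q r assume p: "p \<in> seqs" and q: "q \<in> seqs"
  obtain K L where K: "K \<in> lists A" "p = build K" and L: "L \<in> lists A" "q = build L"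
    using p q seqs_build by blast
  show "psum p q \<in> seqs"
    using q K by (simp add: psum_build)
  show "pmt p q \<in> seqs"
    using p q by simp
  show "psum p q = psum q p"
    using p q K L foldr_ins_build[of K L] by (simp add: psum_build)
  show "psum p origin = p"
    using K by (simp add: psum_build) (simp add: build_def)
  show "pmt p q = pmt q p" "pmt p p = p"
    using p q by (auto simp: pmt_def seqsD mt_comm)
  assume r: "r \<in> seqs"
  then obtain H where H: "H \<in> lists A" "r = build H"
    using seqs_build by blast
  \<comment> \<open>In terms of summands, addition is concatenation of lists, whence
    associativity.\<close>
  have "psum p q = build (K @ L)"
    using K L by (simp add: psum_build) (simp add: build_def)
  then show "psum (psum p q) r = psum p (psum q r)"
    using K L r by (simp add: psum_build)
  show "psum r p = psum r q \<Longrightarrow> p = q"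
    using H p q foldr_ins_inj[of H p q] by (simp add: psum_build)
  show "pmt (pmt p q) r = pmt p (pmt q r)"
    using p q r by (auto simp: pmt_def seqsD mt_assoc)
  show "psum p (pmt q r) = pmt (psum p q) (psum p r)"
    using K q r by (simp add: psum_build foldr_ins_pmt)
next
  show "pmt origin (build [u]) = origin"
  proof
    show "pmt origin (build [u]) k = origin k" for k
      by (cases k) (simp_all add: pmt_def build_def origin_def mt_comm z_le[unfolded le_def])
  qed
  show "inj_on (\<lambda>(s, t). f (decomp s, decomp t)) (seqs \<times> seqs)"
  proof (rule inj_onI; clarify)
    fix s t s' t' assume S: "s \<in> seqs" "t \<in> seqs" "s' \<in> seqs" "t' \<in> seqs"
      and "f (decomp s, decomp t) = f (decomp s', decomp t')"
    then have "(decomp s, decomp t) = (decomp s', decomp t')"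
      by (intro injD[OF assms])
    then have "build (decomp s) = build (decomp s')" "build (decomp t) = build (decomp t')"
      by simp_all
    then show "s = s' \<and> t = t'"
      by (simp only: decomp(2) S simp_thms)
  qed
qed simp_all

end

section \<open>The embedding\<close>

context mv_monoidal
begin

section \<open>Elements of the algebra as one-term sums, and the sums formed from them\<close>

lemma build_single:
  "a \<in> A \<Longrightarrow> build [a] 0 = u" "a \<in> A \<Longrightarrow> build [a] (Suc 0) = a" "a \<in> A \<Longrightarrow> build [a] (Suc (Suc i)) = z"
  by (simp_all add: build_def origin_def)

lemma build_pair:
  assumes "x \<in> A" "y \<in> A"
  shows "build [x, y] 0 = u" "build [x, y] (Suc 0) = x \<oplus> y" "build [x, y] (Suc (Suc 0)) = x \<odot> y"
    "build [x, y] (Suc (Suc (Suc i))) = z"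
  using assms by (simp_all add: build_def origin_def pl_comm)

lemma nat_cases4:
  obtains "k = 0" | "k = Suc 0" | "k = Suc (Suc 0)" | i where "k = Suc (Suc (Suc i))"
  by (metis nat.exhaust)

lemma seq_eqI:
  assumes "s 0 = t 0" "s (Suc 0) = t (Suc 0)" "s (Suc (Suc 0)) = t (Suc (Suc 0))"
    "\<And>i. s (Suc (Suc (Suc i))) = t (Suc (Suc (Suc i)))"
  shows "s = t"
proof
  show "s k = t k" for k
    by (cases k rule: nat_cases4) (use assms in simp_all)
qed

text \<open>Distributing over the join gives the upper bound, over the meet the lower one. With
  \<open>jn_tm_mt\<close> it yields \<open>build_jn\<close>, which serves the condition of
  \<open>mv_jn_unit\<close>.\<close>

lemma jn_pl_mt:
  assumes "x \<in> A" "y \<in> A"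
  shows "(x \<squnion> y) \<oplus> (x \<sqinter> y) = x \<oplus> y"
proof (rule le_antisym)
  have "(x \<sqinter> y) \<oplus> x \<preceq> x \<oplus> y" "(x \<sqinter> y) \<oplus> y \<preceq> x \<oplus> y"
    using assms pl_mono[of "x \<sqinter> y" y x] pl_mono[of "x \<sqinter> y" x y] by (simp_all add: pl_comm)
  then show "(x \<squnion> y) \<oplus> (x \<sqinter> y) \<preceq> x \<oplus> y"
    using assms by (simp add: pl_comm[of "x \<squnion> y"] pl_jn jn_least)
  have "x \<oplus> y \<preceq> (x \<squnion> y) \<oplus> x" "x \<oplus> y \<preceq> (x \<squnion> y) \<oplus> y"
    using assms pl_mono[of y "x \<squnion> y" x] pl_mono[of x "x \<squnion> y" y] by (simp_all add: pl_comm)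
  then show "x \<oplus> y \<preceq> (x \<squnion> y) \<oplus> (x \<sqinter> y)"
    using assms by (simp add: pl_mt le_mt_iff)
qed (use assms in simp_all)

lemma jn_tm_mt:
  assumes "x \<in> A" "y \<in> A"
  shows "(x \<squnion> y) \<odot> (x \<sqinter> y) = x \<odot> y"
proof (rule le_antisym)
  have "(x \<sqinter> y) \<odot> x \<preceq> x \<odot> y" "(x \<sqinter> y) \<odot> y \<preceq> x \<odot> y"
    using assms tm_mono[of "x \<sqinter> y" y x] tm_mono[of "x \<sqinter> y" x y] by (simp_all add: tm_comm)
  then show "(x \<squnion> y) \<odot> (x \<sqinter> y) \<preceq> x \<odot> y"
    using assms by (simp add: tm_comm[of "x \<squnion> y"] tm_jn jn_least)
  have "x \<odot> y \<preceq> (x \<squnion> y) \<odot> x" "x \<odot> y \<preceq> (x \<squnion> y) \<odot> y"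
    using assms tm_mono[of y "x \<squnion> y" x] tm_mono[of x "x \<squnion> y" y] by (simp_all add: tm_comm)
  then show "x \<odot> y \<preceq> (x \<squnion> y) \<odot> (x \<sqinter> y)"
    using assms by (simp add: tm_mt le_mt_iff)
qed (use assms in simp_all)

lemma mt_u [simp]: "x \<in> A \<Longrightarrow> x \<sqinter> u = x" "x \<in> A \<Longrightarrow> u \<sqinter> x = x"
  and mt_z [simp]: "x \<in> A \<Longrightarrow> x \<sqinter> z = z" "x \<in> A \<Longrightarrow> z \<sqinter> x = z"
  using le_u[of x] z_le[of x] unfolding le_def by (simp_all add: mt_comm)

lemma good_sum_product: "x \<in> A \<Longrightarrow> y \<in> A \<Longrightarrow> good (x \<oplus> y) (x \<odot> y)"
  using seqsD(2)[of "build [x, y]" "Suc 0"] by (simp add: build_pair)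

lemma psum_singles:
  "x \<in> A \<Longrightarrow> y \<in> A \<Longrightarrow> psum (build [x]) (build [y]) = build [x, y]"
  "x \<in> A \<Longrightarrow> y \<in> A \<Longrightarrow> w \<in> A \<Longrightarrow> psum (build [w]) (build [x, y]) = build [w, x, y]"
  by (simp_all add: psum_build) (simp_all add: build_def)

lemma build_z: "build [z] = origin"
  by (rule seq_eqI) (simp_all add: build_single origin_def)

lemma build_pl:
  assumes "x \<in> A" "y \<in> A"
  shows "build [x \<oplus> y] = pmt (build [x, y]) (build [u])"
  by (rule seq_eqI) (use assms in \<open>simp_all add: build_single build_pair pmt_def\<close>)

text \<open>Adding 1 shifts the list of truncations, because each entry absorbs its
  successor.\<close>

lemma ins_u:
  assumes "s \<in> seqs"
  shows "ins u s (Suc i) = s i"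
  using goodD(3)[OF seqsD(2)[OF assms, of i]] seqsD(3)[OF assms] by (simp add: pl_comm)

text \<open>The condition of \<open>mv_tm_unit\<close>. From index 1 on, \<open>1 + x + y\<close>
  has the entries \<open>u\<close>, \<open>x \<oplus> y\<close>, \<open>x \<odot> y\<close>; the
  meet with \<open>1 + 1\<close> deletes the third, and adding \<open>x \<odot> y\<close> restores
  it, as \<open>x \<oplus> y\<close> and \<open>x \<odot> y\<close> form a good pair.\<close>

lemma build_tm:
  assumes "x \<in> A" "y \<in> A"
  shows "psum (build [x \<odot> y]) (pmt (build [u, u]) (build [u, x, y])) = build [u, x, y]"
proof -
  have "build [u, x, y] = ins u (build [x, y])"
    by (simp add: build_def)
  then have 3: "build [u, x, y] (Suc (Suc i)) = build [x, y] (Suc i)" "build [u, x, y] (Suc 0) = u"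
      "build [u, x, y] 0 = u" for i
    using assms ins_u[of "build [x, y]"] by (simp_all add: build_pair del: ins_simps(2))
  note g = goodD[OF good_sum_product[OF assms]]
  let ?t = "pmt (build [u, u]) (build [u, x, y])"
  have t: "?t 0 = u" "?t (Suc 0) = u" "?t (Suc (Suc 0)) = x \<oplus> y" "?t (Suc (Suc (Suc i))) = z" for i
    using assms by (simp_all add: pmt_def 3 build_pair seqsD)
  have "psum (build [x \<odot> y]) ?t = ins (x \<odot> y) ?t"
    using assms by (simp add: psum_build)
  also have "\<dots> = build [u, x, y]"
  proof
    fix k show "ins (x \<odot> y) ?t k = build [u, x, y] k"
    proof (cases k rule: nat_cases4)
      case (4 i)
      then show ?thesis
        using assms g by (cases i) (simp_all add: t 3 build_pair tm_comm)
    qed (use assms g in \<open>simp_all add: t 3 build_pair\<close>)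
  qed
  finally show ?thesis .
qed

lemma build_jn:
  assumes "x \<in> A" "y \<in> A"
  shows "build [x \<squnion> y, x \<sqinter> y] = build [x, y]"
  by (rule seq_eqI) (use assms in \<open>simp_all add: build_pair jn_pl_mt jn_tm_mt\<close>)

lemma build_mt:
  assumes "x \<in> A" "y \<in> A"
  shows "pmt (build [x]) (build [y]) = build [x \<sqinter> y]"
  by (rule seq_eqI) (use assms in \<open>simp_all add: build_single pmt_def\<close>)

end

context cancellative_mv_monoidal
begin

lemma positive: "positive_MV A pl tm jn mt z u TYPE('a + nat)"
proof -
  obtain f :: "'a list \<times> 'a list \<Rightarrow> 'a + nat" where "inj f"
    using ex_inj_list_pair by blast
  then interpret Q: unital_cancel_monoid seqs psum pmt origin "build [u]"
      "\<lambda>(s, t). f (decomp s, decomp t)"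
    by (rule unital_cancel_monoid_seqs)
  \<comment> \<open>The element \<open>a\<close> is sent to the class of the one-term sum
    \<open>[a]\<close> minus zero.\<close>
  define h where "h a = Q.cls (build [a], origin)" for a
  have D: "(build [a], origin) \<in> Q.D" if "a \<in> A" for a
  proof (rule Q.unit_interval_D)
    show "pmt origin (build [a]) = origin" "pmt (build [a]) (build [u]) = build [a]"
      using build_mt[of z a] build_mt[of a u] that by (simp_all add: build_z)
  qed (use that in simp)
  have "inj_on h A"
  proof (rule inj_onI)
    fix x y assume xy: "x \<in> A" "y \<in> A" and "h x = h y"
    then have "Q.equ (build [x], origin) (build [y], origin)"
      using Q.cls_eq_iff[OF D D] by (simp only: h_def)
    then have "build [x] = build [y]"
      using xy by simp
    then have "build [x] (Suc 0) = build [y] (Suc 0)"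
      by simp
    then show "x = y"
      using xy by (simp add: build_single)
  qed
  moreover have "h (x \<oplus> y) = Q.mv_pl (h x) (h y)" if "x \<in> A" "y \<in> A" for x y
    unfolding h_def using D that
    by (intro Q.mv_pl_unit[symmetric]) (simp_all add: psum_singles build_pl)
  moreover have "h (x \<odot> y) = Q.mv_tm (h x) (h y)" if "x \<in> A" "y \<in> A" for x y
    unfolding h_def using D that
    by (intro Q.mv_tm_unit[symmetric]) (simp_all add: psum_singles build_tm)
  moreover have "h (x \<squnion> y) = Q.mv_jn (h x) (h y)" if "x \<in> A" "y \<in> A" for x y
    unfolding h_def using D that
    by (intro Q.mv_jn_unit[symmetric]) (simp_all add: psum_singles build_mt build_jn)
  moreover have "h (x \<sqinter> y) = Q.mv_mt (h x) (h y)" if "x \<in> A" "y \<in> A" for x y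
    unfolding h_def build_mt[OF that, symmetric] using D[of "x \<sqinter> y"] D that
    by (intro Q.mv_mt_unit[symmetric]) (simp_all add: build_mt)
  ultimately have "pos_embedding h A pl tm jn mt z u (Q.cls ` Q.D) Q.mv_pl Q.mv_tm Q.mv_jn Q.mv_mt
      (Q.cls (origin, origin)) (Q.cls (build [u], origin))"
    using D by (simp add: pos_embedding_def image_subset_iff) (simp add: h_def build_z)
  moreover have "closed_alg A pl tm jn mt z u"
    using mv_monoidal by (simp add: MV_monoidal_def)
  ultimately show ?thesis
    unfolding positive_MV_def using Q.MV_algebra_cls by blast
qed

end

text \<open>Types cannot be quantified inside a formula, so the equivalence is stated as two
  implications: the first for an ambient MV-algebra in an arbitrary type \<open>'b\<close>, the
  second with one in the specific type \<open>'a + nat\<close>.\<close>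

theorem theorem4:
  fixes A :: "'a set" and pl tm jn mt :: "'a \<Rightarrow> 'a \<Rightarrow> 'a" and z u :: 'a
  shows "(positive_MV A pl tm jn mt z u TYPE('b) \<longrightarrow>
            MV_monoidal A pl tm jn mt z u \<and> cancellative A pl tm) \<and>
         (MV_monoidal A pl tm jn mt z u \<and> cancellative A pl tm \<longrightarrow>
            positive_MV A pl tm jn mt z u TYPE('a + nat))"
proof (intro conjI[of "_ \<longrightarrow> _"] impI)
  show "MV_monoidal A pl tm jn mt z u \<and> cancellative A pl tm"
    if "positive_MV A pl tm jn mt z u TYPE('b)"
    using that by (rule positive_MV_imp_monoidal)
  show "positive_MV A pl tm jn mt z u TYPE('a + nat)"
    if "MV_monoidal A pl tm jn mt z u \<and> cancellative A pl tm"
  proof -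
    interpret cancellative_mv_monoidal A pl tm jn mt z u
      using that by unfold_locales simp_all
    show ?thesis
      by (rule positive)
  qed
qed

end
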